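(* Let $G$ be a connected $4$-regular graph with $q(G)=2$. Then $G$ is isomorphic to one of the following: (1) $K_5$; (2) one of $R_{7,1}, R_{8,2}, R_{8,3}, R_{8,4}, R_{8,5}, R_{8,6}$; (3) $K_3\Box C_4$, $K_{3,3}\Box K_2$, or one of $R_{10,2}, R_{10,3}, R_{10,4}, R_{12,3}, R_{14,1}$; (4) the hypercube $Q_4$; or (5) a closed candle $H_k$ for some $k\ge 3$.
   Context: All graphs are finite, simple, undirected. For a connected graph $G$ on $n$ vertices, $\mathcal{S}(G)$ is the set of all real symmetric $n\times n$ matrices $A=[a_{ij}]$ such that for $i\neq j$, $a_{ij}\neq 0$ if and only if $\{i,j\}$ is an edge of $G$ (diagonal entries are arbitrary). $q(G)$ is the minimum number of distinct eigenvalues of a matrix in $\mathcal{S}(G)$. $\Box$ denotes the Cartesian product of graphs; $Q_4$ is the $4$-fold Cartesian product of $K_2$ with itself. The circulant graph $C(n,\pm i,\pm j)$ has vertex set $\mathbb{Z}/n\mathbb{Z}$ with $t$ adjacent to $t\pm i$ and $t\pm j$. For $k\ge 3$, the closed candle $H_k$ has vertex set $\{1,\dots,2k\}$; the odd vertices form a cycle $1,3,5,\dots,2k-1,1$, the even vertices form a cycle $2,4,\dots,2k,2$, and additionally an odd vertex $i$ is adjacent to an even vertex $j$ iff $j-i=3$, or $j-i=-1$, or $(i,j)=(2k-1,2)$, or $(i,j)=(1,2k)$. (It is $4$-regular.) The sporadic graphs are: $R_{7,1}=C(7,\pm1,\pm2)$; $R_{8,5}=K_4\Box K_2$; $R_{8,6}=C(8,\pm1,\pm2)$;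 $R_{10,4}=C(10,\pm1,\pm3)$; $R_{12,3}=C(12,\pm1,\pm3)$; $R_{8,2}$ on $\{1,\dots,8\}$ with edges $12,13,16,18,23,25,28,34,37,45,46,48,56,57,67,78$; $R_{8,3}$ on $\{1,\dots,8\}$ with edges $12,14,15,18,23,25,26,34,36,37,47,48,57,58,67,68$; $R_{8,4}$ on $\{1,\dots,8\}$ with edges $12,15,17,18,23,24,25,34,37,38,45,46,56,67,68,78$; $R_{10,2}$ on $\{1,\dots,10\}$ with edges $1\text{-}2,1\text{-}5,1\text{-}8,1\text{-}10,2\text{-}3,2\text{-}6,2\text{-}9,3\text{-}4,3\text{-}7,3\text{-}10,4\text{-}5,4\text{-}8,4\text{-}9,5\text{-}6,5\text{-}10,6\text{-}7,6\text{-}9,7\text{-}8,7\text{-}10,8\text{-}9$; $R_{10,3}$ on $\{1,\dots,10\}$ with edges $1\text{-}2,1\text{-}3,1\text{-}4,1\text{-}5,2\text{-}3,2\text{-}4,2\text{-}5,6\text{-}7,6\text{-}8,6\text{-}9,6\text{-}10,7\text{-}8,7\text{-}9,7\text{-}10,3\text{-}8,3\text{-}10,4\text{-}8,4\text{-}9,5\text{-}9,5\text{-}10$ (equivalently, obtained from the cube $Q_3$ by adding, for each vertex $x$ of a pair of antipodal vertices, a new vertex adjacent to $x$ and to all neighbors of $x$); $R_{14,1}$ on $\{1,\dots,14\}$, bipartite with vertex $i\in\{1,\dots,7\}$ adjacent to: $1:\{8,10,13,14\}$, $2:\{8,9,11,14\}$, $3:\{8,9,10,12\}$, $4:\{9,10,11,13\}$,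 $5:\{10,11,12,14\}$, $6:\{8,11,12,13\}$, $7:\{9,12,13,14\}$. *)

theory Defs
  imports
    "Graph_Theory.Graph_Theory"
    "Jordan_Normal_Form.Spectral_Radius"
begin

text \<open>
  Finite simple undirected graphs are the symmetric loop-free pair digraphs of the locale
  \<^locale>\<open>pair_graph\<close>: an edge \<open>{u, v}\<close> is represented by the two arcs \<open>(u, v)\<close> and
  \<open>(v, u)\<close>, so the degree of a vertex is its out-degree.
\<close>

abbreviation graph_iso :: "'a pair_pre_digraph \<Rightarrow> 'b pair_pre_digraph \<Rightarrow> bool" where
  "graph_iso G H \<equiv> digraph_iso (with_proj G) (with_proj H)"

text \<open>
  The set \<open>\<S>(G)\<close>. Rows and columns of a matrix are numbered \<open>0, \<dots>, n - 1\<close>, so the vertices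
  have to be numbered as well; every numbering \<open>\<nu>\<close> is admitted. Renumbering conjugates by a
  permutation matrix and does not change the spectrum.
\<close>

definition sym_mats :: "'a pair_pre_digraph \<Rightarrow> real mat set" where
  "sym_mats G = {A. A \<in> carrier_mat (card (pverts G)) (card (pverts G)) \<and> transpose_mat A = A \<and>
     (\<exists>\<nu>. bij_betw \<nu> {..<card (pverts G)} (pverts G) \<and>
       (\<forall>i<card (pverts G). \<forall>j<card (pverts G). i \<noteq> j \<longrightarrow>
          (A $$ (i, j) \<noteq> 0 \<longleftrightarrow> (\<nu> i, \<nu> j) \<in> parcs G)))}"

definition q_graph :: "'a pair_pre_digraph \<Rightarrow> nat" where
  "q_graph G = (LEAST m. \<exists>A \<in> sym_mats G. m = card (spectrum A))"

definition undirected :: "'a set \<Rightarrow> ('a \<times> 'a) set \<Rightarrow> 'a pair_pre_digraph" where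
  "undirected V E = \<lparr> pverts = V, parcs = E \<union> E\<inverse> \<rparr>"

definition complete_graph :: "nat \<Rightarrow> nat pair_pre_digraph" where
  "complete_graph n = undirected {..<n} {(u, v). u < n \<and> v < n \<and> u \<noteq> v}"

definition complete_bipartite_graph :: "nat \<Rightarrow> nat \<Rightarrow> (nat + nat) pair_pre_digraph" where
  "complete_bipartite_graph m n =
     undirected ({..<m} <+> {..<n}) {(Inl u, Inr v) | u v. u < m \<and> v < n}"

text \<open>
  \<open>C(n, \<plusminus>d : d \<in> D)\<close>, with \<open>\<int>/n\<int>\<close> represented by the residues \<open>0, \<dots>, n - 1\<close>.
\<close>

definition circulant :: "nat \<Rightarrow> nat set \<Rightarrow> nat pair_pre_digraph" where
  "circulant n D = undirected {..<n} {(t, (t + d) mod n) | t d. t < n \<and> d \<in> D}"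

definition cycle_graph :: "nat \<Rightarrow> nat pair_pre_digraph" where
  "cycle_graph n = circulant n {1}"

definition cartesian_product ::
    "'a pair_pre_digraph \<Rightarrow> 'b pair_pre_digraph \<Rightarrow> ('a \<times> 'b) pair_pre_digraph"
    (infixl \<open>\<box>\<close> 70) where
  "G \<box> H = \<lparr> pverts = pverts G \<times> pverts H,
     parcs = {((u, v), (u', v')) | u v u' v'.
       (u = u' \<and> u \<in> pverts G \<and> (v, v') \<in> parcs H) \<or>
       ((u, u') \<in> parcs G \<and> v = v' \<and> v \<in> pverts H)} \<rparr>"

definition hypercube4 :: "(((nat \<times> nat) \<times> nat) \<times> nat) pair_pre_digraph" where
  "hypercube4 = complete_graph 2 \<box> complete_graph 2 \<box> complete_graph 2 \<box> complete_graph 2"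

definition closed_candle :: "nat \<Rightarrow> nat pair_pre_digraph" where
  "closed_candle k = undirected {1..2*k}
     ({(i, i + 2) | i. odd i \<and> i + 2 \<le> 2*k - 1} \<union> {(2*k - 1, 1)} \<union>
      {(i, i + 2) | i. even i \<and> 2 \<le> i \<and> i + 2 \<le> 2*k} \<union> {(2*k, 2)} \<union>
      {(i, j). i \<in> {1..2*k} \<and> j \<in> {1..2*k} \<and> odd i \<and> even j \<and>
         (int j - int i = 3 \<or> int j - int i = -1 \<or> (i, j) = (2*k - 1, 2) \<or> (i, j) = (1, 2*k))})"

definition R_7_1 :: "nat pair_pre_digraph" where
  "R_7_1 = circulant 7 {1, 2}"

definition R_8_2 :: "nat pair_pre_digraph" where
  "R_8_2 = undirected {1..8}
     {(1,2), (1,3), (1,6), (1,8), (2,3), (2,5), (2,8), (3,4),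
      (3,7), (4,5), (4,6), (4,8), (5,6), (5,7), (6,7), (7,8)}"

definition R_8_3 :: "nat pair_pre_digraph" where
  "R_8_3 = undirected {1..8}
     {(1,2), (1,4), (1,5), (1,8), (2,3), (2,5), (2,6), (3,4),
      (3,6), (3,7), (4,7), (4,8), (5,7), (5,8), (6,7), (6,8)}"

definition R_8_4 :: "nat pair_pre_digraph" where
  "R_8_4 = undirected {1..8}
     {(1,2), (1,5), (1,7), (1,8), (2,3), (2,4), (2,5), (3,4),
      (3,7), (3,8), (4,5), (4,6), (5,6), (6,7), (6,8), (7,8)}"

definition R_8_5 :: "(nat \<times> nat) pair_pre_digraph" where
  "R_8_5 = complete_graph 4 \<box> complete_graph 2"

definition R_8_6 :: "nat pair_pre_digraph" where
  "R_8_6 = circulant 8 {1, 2}"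

definition R_10_2 :: "nat pair_pre_digraph" where
  "R_10_2 = undirected {1..10}
     {(1,2), (1,5), (1,8), (1,10), (2,3), (2,6), (2,9), (3,4), (3,7), (3,10),
      (4,5), (4,8), (4,9), (5,6), (5,10), (6,7), (6,9), (7,8), (7,10), (8,9)}"

definition R_10_3 :: "nat pair_pre_digraph" where
  "R_10_3 = undirected {1..10}
     {(1,2), (1,3), (1,4), (1,5), (2,3), (2,4), (2,5), (6,7), (6,8), (6,9),
      (6,10), (7,8), (7,9), (7,10), (3,8), (3,10), (4,8), (4,9), (5,9), (5,10)}"

definition R_10_4 :: "nat pair_pre_digraph" where
  "R_10_4 = circulant 10 {1, 3}"

definition R_12_3 :: "nat pair_pre_digraph" where
  "R_12_3 = circulant 12 {1, 3}"

definition R_14_1 :: "nat pair_pre_digraph" where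
  "R_14_1 = undirected {1..14}
     ({1} \<times> {8, 10, 13, 14} \<union> {2} \<times> {8, 9, 11, 14} \<union> {3} \<times> {8, 9, 10, 12} \<union>
      {4} \<times> {9, 10, 11, 13} \<union> {5} \<times> {10, 11, 12, 14} \<union> {6} \<times> {8, 11, 12, 13} \<union>
      {7} \<times> {9, 12, 13, 14})"

end

theory Submission
  imports Defs "Jordan_Normal_Form.Jordan_Normal_Form_Uniqueness"
begin

text \<open>
  A symmetric matrix with two distinct eigenvalues satisfies a quadratic equation. Reading off
  its off-diagonal entries, two non-adjacent vertices never have exactly one common neighbour,
  and if they have exactly two, the four weights of the resulting quadrangle have negative product;
  an edge in no triangle has opposite (shifted) diagonal entries at its ends.

  The first condition alone is so restrictive for connected 4-regular graphs that an exhaustive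
  search, started in turn from \<open>K\<^sub>4\<close>, \<open>K\<^sub>4\<close> minus an edge, a triangle, \<open>K\<^sub>2\<^sub>,\<^sub>4\<close>, \<open>K\<^sub>2\<^sub>,\<^sub>3\<close> and
  a single vertex, ends after some 500 steps in one of 23 graphs or in five consecutive twin pairs
  of a candle. Such a sequence of twin pairs extends until it closes up. Five of the 23 graphs are
  excluded by the sign and diagonal conditions.
\<close>

section \<open>Symmetric matrices with two eigenvalues\<close>

text \<open>The condition on common neighbours bounds local growth: at most 12 edges lead from the
  neighbours of a vertex to distance two, and each vertex there receives at least two of them, so
  there are at most six such vertices. The obstacle to a purely finite search is the infinite family
  of candles. Five consecutive twin pairs are accepted as an end because the extension argument
  needs the complete neighbourhoods of the three pairs before the last one, hence one more pair in
  front of these.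

  Denser starting patterns come first so that sparser ones may treat them as excluded. The search is
  run as a refutation: the 23 graphs and the five pairs are assumed not to occur, and it follows
  that not even a single vertex occurs. The proof tree itself is untrusted data. Only the checker is
  proved sound, and its case distinctions are exhaustive because of degree four and the second
  common neighbour.

  The diagonal entries are shifted by half the sum of the two eigenvalues, which absorbs the linear
  term of the quadratic equation off the diagonal.\<close>

lemma real_symmetric_eigenvalue_real:
  fixes A :: "real mat"
  assumes A: "A \<in> carrier_mat n n" and sym: "transpose_mat A = A"
    and ev: "eigenvalue (map_mat complex_of_real A) a"
  shows "a \<in> \<real>"
proof -
  let ?M = "map_mat complex_of_real A"
  have M: "?M \<in> carrier_mat n n" using A by auto
  have Mt: "transpose_mat ?M = ?M" using sym by (metis map_mat_transpose)
  obtain v where v: "v \<in> carrier_vec n" "v \<noteq> 0\<^sub>v n" "?M *\<^sub>v v = a \<cdot>\<^sub>v v"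
    using ev A unfolding eigenvalue_def eigenvector_def by auto
  have cv: "conjugate v \<in> carrier_vec n" using v by auto
  have conj: "?M *\<^sub>v conjugate v = conjugate (?M *\<^sub>v v)"
    using A v(1) by (intro eq_vecI) (auto simp: scalar_prod_def sum_conjugate)
  have "a * (v \<bullet>c v) = (?M *\<^sub>v v) \<bullet>c v" using v cv by simp
  also have "\<dots> = v \<bullet> (?M *\<^sub>v conjugate v)"
    using transpose_vec_mult_scalar[OF M v(1) cv] Mt comm_scalar_prod v(1) cv M
    by (metis mult_mat_vec_carrier)
  also have "\<dots> = conjugate a * (v \<bullet>c v)" using v cv unfolding conj v(3) by (simp add: conjugate_smult_vec)
  finally have "a = conjugate a" using conjugate_square_eq_0_vec[OF v(1)] v(2) by simp
  then show ?thesis by (metis Reals_cnj_iff conjugate_complex_def)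
qed

text \<open>Over the complex numbers the characteristic polynomial splits. Its roots are eigenvalues
  of a Hermitian matrix and hence real, so the factorization already holds over the reals, where it
  yields a Jordan form.\<close>

lemma real_symmetric_jordan_nf:
  fixes A :: "real mat"
  assumes A: "A \<in> carrier_mat n n" and sym: "transpose_mat A = A"
  shows "\<exists>n_as. jordan_nf A n_as"
proof -
  let ?M = "map_mat complex_of_real A"
  interpret h: map_poly_comm_ring_hom complex_of_real ..
  have M: "?M \<in> carrier_mat n n" using A by auto
  obtain as where as: "char_poly ?M = (\<Prod>a\<leftarrow>as. [:- a, 1:])" using char_poly_factorized[OF M] by auto
  have "a \<in> \<real>" if "a \<in> set as" for a
  proof (rule real_symmetric_eigenvalue_real[OF A sym])
    have "poly (char_poly ?M) a = 0" unfolding as using that by (simp add: poly_prod_list)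
    then show "eigenvalue ?M a" using eigenvalue_root_char_poly[OF M] by simp
  qed
  then have Re: "map (\<lambda>a. complex_of_real (Re a)) as = as" by (auto intro!: map_idI)
  have "map_poly complex_of_real (char_poly A) = char_poly ?M"
    by (rule of_real_hom.char_poly_hom[OF A, symmetric])
  also have "\<dots> = (\<Prod>a\<leftarrow>map (\<lambda>a. complex_of_real (Re a)) as. [:- a, 1:])"
    unfolding Re by (rule as)
  also have "\<dots> = map_poly complex_of_real (\<Prod>a\<leftarrow>map Re as. [:- a, 1:])"
    by (induction as) (simp_all add: h.hom_mult del: mult_pCons_left)
  finally have eq: "map_poly complex_of_real (char_poly A) =
    map_poly complex_of_real (\<Prod>a\<leftarrow>map Re as. [:- a, 1:])" .
  have "char_poly A = (\<Prod>a\<leftarrow>map Re as. [:- a, 1:])"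
  proof (rule poly_eqI)
    show "coeff (char_poly A) i = coeff (\<Prod>a\<leftarrow>map Re as. [:- a, 1:]) i" for i
      using arg_cong[OF eq, of "\<lambda>p. coeff p i"] by (simp only: coeff_map_poly of_real_0 of_real_eq_iff)
  qed
  then show ?thesis by (rule jordan_nf_exists[OF A])
qed

text \<open>The matrix \<open>C = A - a I\<close> is symmetric, so \<open>C (C v) = 0\<close> gives
  \<open>|C v|^2 = v . C (C v) = 0\<close>. No Jordan chain has length two.\<close>

lemma symmetric_dim_gen_eigenspace:
  fixes A :: "real mat"
  assumes A: "A \<in> carrier_mat n n" and sym: "transpose_mat A = A"
  shows "dim_gen_eigenspace A a 2 = dim_gen_eigenspace A a 1"
proof -
  let ?C = "char_matrix A a"
  have C: "?C \<in> carrier_mat n n" using A by simp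
  have "A $$ (i, j) = A $$ (j, i)" if "i < n" "j < n" for i j
    using that A sym by (metis carrier_matD index_transpose_mat(1))
  then have Ct: "transpose_mat ?C = ?C"
    using A unfolding char_matrix_def by (intro eq_matI) auto
  have C2: "?C ^\<^sub>m 2 = ?C * ?C" using C by (simp add: numeral_2_eq_2)
  have C1: "?C ^\<^sub>m 1 = ?C" using C by simp
  have CC: "?C * ?C \<in> carrier_mat n n" using C by simp
  have "mat_kernel (?C * ?C) = mat_kernel ?C"
  proof (intro equalityI subsetI)
    fix v assume "v \<in> mat_kernel (?C * ?C)"
    then have v: "v \<in> carrier_vec n" "?C *\<^sub>v (?C *\<^sub>v v) = 0\<^sub>v n"
      using mat_kernelD[OF CC] assoc_mult_mat_vec[OF C C] by auto
    have Cv: "?C *\<^sub>v v \<in> carrier_vec n" using C v by simp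
    have "(?C *\<^sub>v v) \<bullet>c (?C *\<^sub>v v) = (?C *\<^sub>v v) \<bullet> (?C *\<^sub>v v)" by simp
    also have "\<dots> = v \<bullet> (?C *\<^sub>v (?C *\<^sub>v v))"
      using transpose_vec_mult_scalar[OF C v(1) Cv] Ct comm_scalar_prod v(1) Cv C
      by (metis mult_mat_vec_carrier)
    also have "\<dots> = 0" using v by simp
    finally have "?C *\<^sub>v v = 0\<^sub>v n" using conjugate_square_eq_0_vec[OF Cv] by simp
    then show "v \<in> mat_kernel ?C" by (rule mat_kernelI[OF C v(1)])
  next
    fix v assume "v \<in> mat_kernel ?C"
    then have v: "v \<in> carrier_vec n" "?C *\<^sub>v v = 0\<^sub>v n" using mat_kernelD[OF C] by auto
    moreover have "?C *\<^sub>v 0\<^sub>v n = 0\<^sub>v n" using C by (intro eq_vecI) auto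
    ultimately have "(?C * ?C) *\<^sub>v v = 0\<^sub>v n" using assoc_mult_mat_vec[OF C C v(1)] by simp
    then show "v \<in> mat_kernel (?C * ?C)" by (rule mat_kernelI[OF CC v(1)])
  qed
  then show ?thesis
    unfolding dim_gen_eigenspace_def C1 C2 kernel_dim_def using C by simp
qed

text \<open>The two dimensions are the sums of \<open>min 2 n\<close> and of \<open>min 1 n\<close>
  over the block sizes \<open>n\<close>. Termwise \<open>min 1 n\<close> is at most
  \<open>min 2 n\<close>, so equal sums force equality in every block.\<close>

lemma real_symmetric_blocks:
  fixes A :: "real mat"
  assumes A: "A \<in> carrier_mat n n" and sym: "transpose_mat A = A" and j: "jordan_nf A n_as"
    and na: "(k, a) \<in> set n_as"
  shows "k = 1"
proof -
  let ?ns = "map fst [(n, e)\<leftarrow>n_as. e = a]"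
  have eq: "(\<Sum>n\<leftarrow>?ns. min 2 n) = (\<Sum>n\<leftarrow>?ns. min 1 n)"
    using symmetric_dim_gen_eigenspace[OF A sym, of a] dim_gen_eigenspace[OF j] by metis
  have "\<forall>n \<in> set ns. min 2 n = min 1 n"
    if "(\<Sum>n\<leftarrow>ns. min 2 n) = (\<Sum>n\<leftarrow>ns. min 1 n)" for ns :: "nat list"
    using that
  proof (induction ns)
    case (Cons m ns)
    have "(\<Sum>n\<leftarrow>ns. min 1 n) \<le> (\<Sum>n\<leftarrow>ns. min 2 n)" by (rule sum_list_mono) auto
    moreover have "min 1 m \<le> min 2 m" by auto
    ultimately have "min 2 m = min 1 m" "(\<Sum>n\<leftarrow>ns. min 2 n) = (\<Sum>n\<leftarrow>ns. min 1 n)"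
      using Cons.prems by simp_all
    then show ?case using Cons.IH by auto
  qed simp
  from this[OF eq] have "min 2 k = min 1 k" using na by force
  moreover have "k \<noteq> 0" using j na unfolding jordan_nf_def by force
  ultimately show ?thesis by (auto simp: min_def split: if_splits)
qed

lemma jordan_matrix_diagonal:
  assumes "\<forall>(n, a) \<in> set n_as. n = 1"
  shows "jordan_matrix n_as =
    mat (length n_as) (length n_as) (\<lambda>(i, j). if i = j then snd (n_as ! i) else 0)"
  using assms
proof (induction n_as)
  case Nil
  show ?case by (rule eq_matI) (auto simp: jordan_matrix_def)
next
  case (Cons ne n_as)
  obtain e where ne: "ne = (1, e)" using Cons.prems by (cases ne) auto
  have len: "sum_list (map fst n_as) = length n_as"
    using Cons.prems by (induction n_as) auto
  have IH: "jordan_matrix n_as =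
      mat (length n_as) (length n_as) (\<lambda>(i, j). if i = j then snd (n_as ! i) else 0)"
    using Cons by auto
  have "jordan_matrix (ne # n_as) = four_block_mat (jordan_block 1 e) (0\<^sub>m 1 (length n_as))
      (0\<^sub>m (length n_as) 1) (jordan_matrix n_as)"
    using jordan_matrix_dim[of n_as] len unfolding ne jordan_matrix_def by (simp add: Let_def)
  also have "\<dots> = mat (Suc (length n_as)) (Suc (length n_as))
      (\<lambda>(i, j). if i = j then snd ((ne # n_as) ! i) else 0)"
    unfolding IH ne by (rule eq_matI) (auto simp: jordan_block_def nth_Cons')
  finally show ?case by simp
qed

text \<open>All blocks having size 1, \<open>A\<close> is similar to a diagonal matrix whose entries
  are roots of \<open>(t - l) * (t - m)\<close>; the resulting identity is conjugated back to
  \<open>A\<close>.\<close>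

lemma symmetric_two_eigenvalues:
  fixes A :: "real mat"
  assumes A: "A \<in> carrier_mat n n" and sym: "transpose_mat A = A" and sp: "spectrum A = {l, m}"
  shows "A * A = (l + m) \<cdot>\<^sub>m A - (l * m) \<cdot>\<^sub>m 1\<^sub>m n"
proof -
  obtain n_as where j: "jordan_nf A n_as" using real_symmetric_jordan_nf[OF A sym] by blast
  define J where "J = jordan_matrix n_as"
  obtain P Q where "similar_mat_wit A J P Q"
    using j unfolding jordan_nf_def J_def similar_mat_def by auto
  from similar_mat_witD2[OF A this] have PQ: "P * Q = 1\<^sub>m n" "Q * P = 1\<^sub>m n" "A = P * J * Q"
    and J: "J \<in> carrier_mat n n" and P: "P \<in> carrier_mat n n" and Q: "Q \<in> carrier_mat n n"
    by auto
  have one: "\<forall>(k, a) \<in> set n_as. k = 1" using real_symmetric_blocks[OF A sym j] by auto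
  have Jd: "J = mat (length n_as) (length n_as) (\<lambda>(i, j). if i = j then snd (n_as ! i) else 0)"
    unfolding J_def by (rule jordan_matrix_diagonal[OF one])
  then have len: "length n_as = n" using J by auto
  have ev: "snd (n_as ! i) = l \<or> snd (n_as ! i) = m" if "i < n" for i
  proof -
    obtain k a where ka: "n_as ! i = (k, a)" by force
    then have mem: "(k, a) \<in> set n_as" using that len by (metis nth_mem)
    then have "k = 1" using one by auto
    have "poly (char_poly A) a = 0"
      unfolding jordan_nf_char_poly[OF j] using mem \<open>k = 1\<close>
      by (auto simp: poly_prod_list prod_list_zero_iff image_iff intro!: bexI[of _ "(k, a)"])
    then have "a \<in> spectrum A" using eigenvalue_root_char_poly[OF A] unfolding spectrum_def by simp
    then show ?thesis using sp ka by auto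
  qed
  have JJ: "J * J = (l + m) \<cdot>\<^sub>m J - (l * m) \<cdot>\<^sub>m 1\<^sub>m n"
  proof (rule eq_matI)
    show "dim_row (J * J) = dim_row ((l + m) \<cdot>\<^sub>m J - (l * m) \<cdot>\<^sub>m 1\<^sub>m n)"
      "dim_col (J * J) = dim_col ((l + m) \<cdot>\<^sub>m J - (l * m) \<cdot>\<^sub>m 1\<^sub>m n)" using J by auto
    fix i k assume "i < dim_row ((l + m) \<cdot>\<^sub>m J - (l * m) \<cdot>\<^sub>m 1\<^sub>m n)"
      "k < dim_col ((l + m) \<cdot>\<^sub>m J - (l * m) \<cdot>\<^sub>m 1\<^sub>m n)"
    then have ik: "i < n" "k < n" using J by auto
    let ?d = "\<lambda>i. snd (n_as ! i)"
    have "(J * J) $$ (i, k) = (\<Sum>x = 0..<n. (if i = x then ?d i else 0) * (if x = k then ?d x else 0))"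
      using J ik len unfolding Jd by (simp add: scalar_prod_def)
    also have "\<dots> = (\<Sum>x = 0..<n. if i = x then ?d i * (if i = k then ?d i else 0) else 0)"
      by (rule sum.cong) auto
    also have "\<dots> = (if i = k then ?d i * ?d i else 0)" using ik by simp
    also have "\<dots> = ((l + m) \<cdot>\<^sub>m J - (l * m) \<cdot>\<^sub>m 1\<^sub>m n) $$ (i, k)"
      using ik len ev[OF ik(1)] unfolding Jd by (auto simp: algebra_simps)
    finally show "(J * J) $$ (i, k) = ((l + m) \<cdot>\<^sub>m J - (l * m) \<cdot>\<^sub>m 1\<^sub>m n) $$ (i, k)" .
  qed
  have PJ: "P * J \<in> carrier_mat n n" using P J by simp
  have "A * A = (P * J) * (Q * (P * J * Q))" 
    unfolding PQ(3) by (rule assoc_mult_mat[OF PJ Q, of _ n]) (use PJ Q in simp)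
  also have "Q * (P * J * Q) = J * Q"
    using assoc_mult_mat[OF Q P J] assoc_mult_mat[OF Q PJ Q] PQ(2) J by simp
  also have "(P * J) * (J * Q) = P * (J * J) * Q"
    using assoc_mult_mat[OF P J J] assoc_mult_mat[OF PJ J Q] by simp
  also have "\<dots> = (l + m) \<cdot>\<^sub>m (P * J * Q) - (l * m) \<cdot>\<^sub>m (P * Q)"
  proof -
    have X: "(l + m) \<cdot>\<^sub>m J \<in> carrier_mat n n" and Y: "(l * m) \<cdot>\<^sub>m 1\<^sub>m n \<in> carrier_mat n n"
      using J by simp_all
    have "P * (J * J) = P * ((l + m) \<cdot>\<^sub>m J) - P * ((l * m) \<cdot>\<^sub>m 1\<^sub>m n)"
      unfolding JJ by (rule mult_minus_distrib_mat[OF P X Y])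
    also have "\<dots> = (l + m) \<cdot>\<^sub>m (P * J) - (l * m) \<cdot>\<^sub>m P"
      using mult_smult_distrib[OF P J] mult_smult_distrib[OF P, of "1\<^sub>m n" n] P by simp
    finally have "P * (J * J) * Q = (l + m) \<cdot>\<^sub>m (P * J) * Q - (l * m) \<cdot>\<^sub>m P * Q"
      using minus_mult_distrib_mat[OF smult_carrier_mat[OF PJ] smult_carrier_mat[OF P] Q] by simp
    then show ?thesis
      using mult_smult_assoc_mat[OF PJ Q] mult_smult_assoc_mat[OF P Q] by simp
  qed
  finally show ?thesis unfolding PQ(1) PQ(3)[symmetric] .
qed

section \<open>From two eigenvalues to weights on the vertices\<close>

lemma sym_mats_nonempty:
  assumes "finite (pverts G)" and sym: "\<And>u v. (u, v) \<in> parcs G \<Longrightarrow> (v, u) \<in> parcs G"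
  shows "sym_mats G \<noteq> {}"
proof -
  let ?n = "card (pverts G)"
  obtain \<nu> where \<nu>: "bij_betw \<nu> {..<?n} (pverts G)"
    using ex_bij_betw_nat_finite[OF assms(1)] by (auto simp: atLeast0LessThan)
  let ?A = "mat ?n ?n (\<lambda>(i, j). if (\<nu> i, \<nu> j) \<in> parcs G then 1 else 0 :: real)"
  have "transpose_mat ?A = ?A" by (rule eq_matI) (auto dest: sym)
  then have "?A \<in> sym_mats G" unfolding sym_mats_def using \<nu> by auto
  then show ?thesis by blast
qed

lemma q_graph_2_weights:
  assumes "pair_graph G" and q: "q_graph G = 2"
  shows "\<exists>w d. (\<forall>u v. w u v = (w v u :: real)) \<and>
    (\<forall>u \<in> pverts G. \<forall>v \<in> pverts G. u \<noteq> v \<longrightarrow> (w u v \<noteq> 0 \<longleftrightarrow> (u, v) \<in> parcs G)) \<and>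
    (\<forall>u \<in> pverts G. \<forall>v \<in> pverts G. u \<noteq> v \<longrightarrow>
      (d u + d v) * w u v + (\<Sum>x | (u, x) \<in> parcs G \<and> (v, x) \<in> parcs G. w u x * w v x) = 0)"
proof -
  interpret pair_graph G by fact
  let ?n = "card (pverts G)" and ?V = "pverts G"
  have sym: "(u, v) \<in> parcs G \<Longrightarrow> (v, u) \<in> parcs G" for u v by (rule arcs_symmetric)
  \<comment> \<open>A value of \<open>LEAST\<close> is attained only if there is a candidate at all,
    hence the need for \<open>sym_mats_nonempty\<close>.\<close>
  have "\<exists>A \<in> sym_mats G. q_graph G = card (spectrum A)"
  proof -
    obtain B where "B \<in> sym_mats G" using sym_mats_nonempty[OF pair_finite_verts sym] by auto
    then have "\<exists>A \<in> sym_mats G. card (spectrum B) = card (spectrum A)" by blast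
    then show ?thesis
      unfolding q_graph_def by (rule LeastI[of "\<lambda>k. \<exists>A \<in> sym_mats G. k = card (spectrum A)"])
  qed
  then obtain A where "A \<in> sym_mats G" and card: "card (spectrum A) = 2" using q by auto
  then obtain \<nu> where A: "A \<in> carrier_mat ?n ?n" "transpose_mat A = A"
    and \<nu>: "bij_betw \<nu> {..<?n} ?V"
    and nz: "\<And>i j. i < ?n \<Longrightarrow> j < ?n \<Longrightarrow> i \<noteq> j \<Longrightarrow> A $$ (i, j) \<noteq> 0 \<longleftrightarrow> (\<nu> i, \<nu> j) \<in> parcs G"
    unfolding sym_mats_def by auto
  obtain l m where sp: "spectrum A = {l, m}" using card by (auto simp: card_2_iff)
  have AA: "A * A = (l + m) \<cdot>\<^sub>m A - (l * m) \<cdot>\<^sub>m 1\<^sub>m ?n" by (rule symmetric_two_eigenvalues[OF A sp])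
  have Asym: "A $$ (i, j) = A $$ (j, i)" if "i < ?n" "j < ?n" for i j
    using that A by (metis carrier_matD index_transpose_mat(1))
  define \<mu> where "\<mu> = the_inv_into {..<?n} \<nu>"
  have \<mu>: "bij_betw \<mu> ?V {..<?n}" unfolding \<mu>_def by (rule bij_betw_the_inv_into[OF \<nu>])
  have \<nu>\<mu>: "\<nu> (\<mu> u) = u" if "u \<in> ?V" for u
    unfolding \<mu>_def using \<nu> that by (simp add: bij_betw_def f_the_inv_into_f)
  have lt: "\<mu> u < ?n" if "u \<in> ?V" for u using bij_betwE[OF \<mu>] that by auto
  have inj: "\<mu> u = \<mu> v \<longleftrightarrow> u = v" if "u \<in> ?V" "v \<in> ?V" for u v
    using \<nu>\<mu> that by metis
  \<comment> \<open>The value 0 outside the vertex set makes \<open>w\<close> symmetric for all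
    arguments.\<close>
  define w where "w u v = (if u \<in> ?V \<and> v \<in> ?V then A $$ (\<mu> u, \<mu> v) else 0)" for u v
  define d where "d u = A $$ (\<mu> u, \<mu> u) - (l + m) / 2" for u
  have wsym: "w u v = w v u" for u v unfolding w_def using Asym lt by auto
  have wnz: "w u v \<noteq> 0 \<longleftrightarrow> (u, v) \<in> parcs G" if "u \<in> ?V" "v \<in> ?V" "u \<noteq> v" for u v
    unfolding w_def using nz[OF lt lt] inj \<nu>\<mu> that by auto
  have "(d u + d v) * w u v + (\<Sum>x | (u, x) \<in> parcs G \<and> (v, x) \<in> parcs G. w u x * w v x) = 0"
    if uv: "u \<in> ?V" "v \<in> ?V" "u \<noteq> v" for u v
  proof -
    let ?i = "\<mu> u" and ?j = "\<mu> v"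
    have ij: "?i < ?n" "?j < ?n" "?i \<noteq> ?j" using lt inj uv by auto
    have "(A * A) $$ (?i, ?j) = (\<Sum>k = 0..<?n. A $$ (?i, k) * A $$ (k, ?j))"
      using A ij by (simp add: scalar_prod_def)
    also have "\<dots> = (\<Sum>k \<in> {..<?n}. A $$ (?i, k) * A $$ (?j, k))"
      using Asym ij by (intro sum.cong) auto
    also have "\<dots> = (\<Sum>x \<in> ?V. w u x * w v x)"
      using uv by (intro sum.reindex_bij_betw[OF \<mu>, symmetric, THEN trans] sum.cong) (auto simp: w_def)
    \<comment> \<open>The terms at \<open>u\<close> and \<open>v\<close> carry the diagonal entries.
      Together with \<open>(l + m) * w u v\<close> from the other side they become
      \<open>(d u + d v) * w u v\<close>.\<close>
    also have "\<dots> = (\<Sum>x \<in> {u, v}. w u x * w v x) + (\<Sum>x \<in> ?V - {u, v}. w u x * w v x)"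
      using pair_finite_verts uv by (subst sum.subset_diff[of "{u, v}"]) auto
    also have "(\<Sum>x \<in> {u, v}. w u x * w v x) = (w u u + w v v) * w u v"
      using uv wsym[of u v] by (simp add: algebra_simps)
    also have "(\<Sum>x \<in> ?V - {u, v}. w u x * w v x) =
        (\<Sum>x | (u, x) \<in> parcs G \<and> (v, x) \<in> parcs G. w u x * w v x)"
    proof (rule sum.mono_neutral_right)
      show "finite (?V - {u, v})" using pair_finite_verts by simp
      show "{x. (u, x) \<in> parcs G \<and> (v, x) \<in> parcs G} \<subseteq> ?V - {u, v}"
        using in_arcsD2 no_loops' by blast
      show "\<forall>x \<in> ?V - {u, v} - {x. (u, x) \<in> parcs G \<and> (v, x) \<in> parcs G}. w u x * w v x = 0"
        using wnz uv by auto
    qed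
    finally have "(A * A) $$ (?i, ?j) = (w u u + w v v) * w u v +
        (\<Sum>x | (u, x) \<in> parcs G \<and> (v, x) \<in> parcs G. w u x * w v x)" .
    moreover have "(A * A) $$ (?i, ?j) = (l + m) * w u v"
      unfolding AA using A ij uv by (simp add: w_def)
    ultimately show ?thesis using uv unfolding d_def by (simp add: w_def algebra_simps)
  qed
  then show ?thesis using wsym wnz by (intro exI[of _ w] exI[of _ d]) blast
qed

section \<open>Excluding partial graphs by certificates\<close>

text \<open>
  A partial graph \<open>(A, Q)\<close> on the vertices \<open>0, \<dots>, length A - 1\<close> lists for each vertex the known
  neighbours (\<open>A\<close>) and some known non-neighbours (\<open>Q\<close>). A certificate is a proof tree showing that
  no realization exists: \<open>Com i j\<close> branches over a second common neighbour of the non-adjacent \<open>i, j\<close>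
  where all neighbours of \<open>i\<close> are known; \<open>Nbr i\<close> branches over a further neighbour of \<open>i\<close>, the last
  branch being a new vertex; \<open>Sub x m\<close> embeds an already excluded partial graph along \<open>m\<close>; and
  \<open>Note x c\<close> records the partial graph excluded by \<open>c\<close> under the number \<open>x\<close>.
\<close>

type_synonym pgraph = "nat list list \<times> nat list list"

datatype cert = Sub nat "nat list" | Com nat nat "cert list" | Nbr nat "cert list" | Note nat cert

text \<open>Non-adjacency derivable from the partial graph: it is recorded, or one of the two
  vertices already has its four neighbours. The last case also tests \<open>i\<close> against the
  list of \<open>j\<close>, as well-formedness does not make the lists symmetric.\<close>

fun absent :: "pgraph \<Rightarrow> nat \<Rightarrow> nat \<Rightarrow> bool" where
  "absent (A, Q) i j \<longleftrightarrow> j \<notin> set (A ! i) \<and>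
     (j \<in> set (Q ! i) \<or> length (A ! i) = 4 \<or> (length (A ! j) = 4 \<and> i \<notin> set (A ! j)))"

definition link :: "nat \<Rightarrow> nat \<Rightarrow> nat list list \<Rightarrow> nat list list" where
  "link i j A = A[i := List.insert j (A ! i), j := List.insert i (A ! j)]"

text \<open>Since \<open>i\<close> is saturated, the second common neighbour is one of its listed
  neighbours. An empty list of children is a contradiction and closes the branch.\<close>

fun com_children :: "pgraph \<Rightarrow> nat \<Rightarrow> nat \<Rightarrow> pgraph list" where
  "com_children (A, Q) i j = map (\<lambda>k. (link k j A, Q))
     (filter (\<lambda>k. k \<notin> set (A ! j) \<and> \<not> absent (A, Q) k j) (A ! i))"

text \<open>Each branch records in \<open>Q\<close> that the candidates before it are not neighbours
  of \<open>i\<close>. After the last candidate the neighbour is a vertex not named so far, which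
  gets the index \<open>length A\<close>.\<close>

fun nbr_children :: "nat \<Rightarrow> nat list \<Rightarrow> pgraph \<Rightarrow> pgraph list" where
  "nbr_children i [] (A, Q) = [(link i (length A) (A @ [[]]), Q @ [[]])]"
| "nbr_children i (j # js) (A, Q) = (link i j A, Q) # nbr_children i js (A, link i j Q)"

text \<open>\<open>m\<close> sends the vertices of the excluded graph \<open>(B, R)\<close> to those
  of \<open>(A, Q)\<close>. The copy need not be induced: listed edges must be present, listed
  non-edges derivable.\<close>

fun embeds :: "nat list \<Rightarrow> pgraph \<Rightarrow> pgraph \<Rightarrow> bool" where
  "embeds m (B, R) (A, Q) \<longleftrightarrow>
     length m = length B \<and> distinct m \<and> (\<forall>x \<in> set m. x < length A) \<and>
     (\<forall>(x, bs) \<in> set (zip m B). \<forall>j \<in> set bs. m ! j \<in> set (A ! x)) \<and>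
     (\<forall>(x, bs) \<in> set (zip m R). \<forall>j \<in> set bs. absent (A, Q) x (m ! j))"

text \<open>The list \<open>K\<close> is threaded through the tree from left to right, so a note
  made in one branch serves in all later ones. It is entered only after its own certificate has been
  accepted, so no reference is circular.\<close>

fun check :: "(nat \<times> pgraph) list \<Rightarrow> pgraph \<Rightarrow> cert \<Rightarrow> (nat \<times> pgraph) list option"
  and check_list ::
    "(nat \<times> pgraph) list \<Rightarrow> pgraph list \<Rightarrow> cert list \<Rightarrow> (nat \<times> pgraph) list option" where
  "check K S (Sub x m) =
     (case map_of K x of None \<Rightarrow> None | Some T \<Rightarrow> if embeds m T S then Some K else None)"
| "check K (A, Q) (Com i j cs) =
     (if i < length A \<and> j < length A \<and> i \<noteq> j \<and> length (A ! i) = 4 \<and> j \<notin> set (A ! i) \<and>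
         length (filter (\<lambda>k. k \<in> set (A ! j)) (A ! i)) = 1
      then check_list K (com_children (A, Q) i j) cs else None)"
| "check K (A, Q) (Nbr i cs) =
     (if i < length A \<and> length (A ! i) < 4
      then check_list K (nbr_children i
        (filter (\<lambda>j. j \<noteq> i \<and> j \<notin> set (A ! i) \<and> \<not> absent (A, Q) i j) [0..<length A]) (A, Q)) cs
      else None)"
| "check K S (Note x c) = (case check K S c of None \<Rightarrow> None | Some K' \<Rightarrow> Some ((x, S) # K'))"
| "check_list K [] [] = Some K"
| "check_list K (S # Ss) (c # cs) =
     (case check K S c of None \<Rightarrow> None | Some K' \<Rightarrow> check_list K' Ss cs)"
| "check_list K _ _ = None"

text \<open>Distinctness is what makes \<open>length (A ! i) = 4\<close> mean that \<open>i\<close>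
  is saturated.\<close>

fun wf_pgraph :: "pgraph \<Rightarrow> bool" where
  "wf_pgraph (A, Q) \<longleftrightarrow> length Q = length A \<and>
     (\<forall>i < length A. distinct (A ! i) \<and> set (A ! i) \<subseteq> {..<length A} \<and> set (Q ! i) \<subseteq> {..<length A})"

lemma length_link [simp]: "length (link i j A) = length A"
  by (simp add: link_def)

lemma set_link_nth:
  assumes "i < length A" "j < length A" "i \<noteq> j" "k < length A"
  shows "set (link i j A ! k) =
    (if k = i then insert j (set (A ! i)) else if k = j then insert i (set (A ! j)) else set (A ! k))"
  using assms by (auto simp: link_def nth_list_update)

lemma distinct_link_nth:
  assumes "i < length A" "j < length A" "k < length A" "i \<noteq> j" "\<forall>k < length A. distinct (A ! k)"
  shows "distinct (link i j A ! k)"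
  using assms by (auto simp: link_def nth_list_update distinct_insert)

lemma wf_link_edge:
  assumes "wf_pgraph (A, Q)" "i < length A" "j < length A" "i \<noteq> j"
  shows "wf_pgraph (link i j A, Q)"
  using assms by (auto simp: set_link_nth distinct_link_nth)

lemma wf_link_nonedge:
  assumes "wf_pgraph (A, Q)" "i < length A" "j < length A" "i \<noteq> j"
  shows "wf_pgraph (A, link i j Q)"
  using assms by (auto simp: set_link_nth)

lemma wf_new_vertex:
  assumes "wf_pgraph (A, Q)"
  shows "wf_pgraph (A @ [[]], Q @ [[]])"
  using assms by (auto simp: nth_append less_Suc_eq) (metis lessThan_iff subsetD)+

lemma wf_com_children:
  assumes "wf_pgraph (A, Q)" "i < length A" "j < length A" "j \<notin> set (A ! i)"
    "T \<in> set (com_children (A, Q) i j)"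
  shows "wf_pgraph T"
proof -
  from assms(5) obtain k where k: "k \<in> set (A ! i)" "T = (link k j A, Q)" by auto
  then have "k < length A" "k \<noteq> j" using assms by auto
  with k wf_link_edge[OF assms(1)] assms show ?thesis by blast
qed

lemma wf_nbr_children:
  assumes "wf_pgraph (A, Q)" "i < length A" "set js \<subseteq> {..<length A} - {i}"
    "T \<in> set (nbr_children i js (A, Q))"
  shows "wf_pgraph T"
  using assms
proof (induction js arbitrary: Q)
  case Nil
  have "wf_pgraph (link i (length A) (A @ [[]]), Q @ [[]])"
    by (rule wf_link_edge[OF wf_new_vertex]) (use Nil in auto)
  with Nil show ?case by simp
next
  case (Cons j js)
  from Cons.prems have "T = (link i j A, Q) \<or> T \<in> set (nbr_children i js (A, link i j Q))"
    by simp
  then show ?case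
  proof
    assume "T = (link i j A, Q)"
    with Cons.prems wf_link_edge[OF Cons.prems(1), of i j] show ?thesis by auto
  next
    assume T: "T \<in> set (nbr_children i js (A, link i j Q))"
    have "wf_pgraph (A, link i j Q)"
      using Cons.prems by (intro wf_link_nonedge) auto
    from Cons.IH[OF this _ _ T] Cons.prems show ?thesis by auto
  qed
qed

text \<open>The combinatorial residue of the spectral hypothesis. Connectedness is stated for sets
  closed under adjacency because this is how it is applied: to the image of a finished graph and to
  the union of a closed chain.\<close>

locale quadrangular =
  fixes V :: "'a set" and E :: "'a \<Rightarrow> 'a \<Rightarrow> bool"
  assumes finite_V: "finite V" and V_nonempty: "V \<noteq> {}"
    and E_V: "E u v \<Longrightarrow> v \<in> V"
    and E_irrefl: "\<not> E u u"
    and E_sym: "E u v \<Longrightarrow> E v u"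
    and degree: "u \<in> V \<Longrightarrow> card {v. E u v} = 4"
    and connectedness: "S \<subseteq> V \<Longrightarrow> S \<noteq> {} \<Longrightarrow> (\<And>u v. u \<in> S \<Longrightarrow> E u v \<Longrightarrow> v \<in> S) \<Longrightarrow> S = V"
    and second_common_neighbour:
      "u \<noteq> v \<Longrightarrow> \<not> E u v \<Longrightarrow> E u w \<Longrightarrow> E v w \<Longrightarrow> \<exists>w'. w' \<noteq> w \<and> E u w' \<and> E v w'"
begin

lemma finite_neighbours: "finite {v. E u v}"
  by (rule finite_subset[OF _ finite_V]) (auto dest: E_V)

fun realizes :: "(nat \<Rightarrow> 'a) \<Rightarrow> pgraph \<Rightarrow> bool" where
  "realizes f (A, Q) \<longleftrightarrow> inj_on f {..<length A} \<and> f ` {..<length A} \<subseteq> V \<and>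
     (\<forall>i < length A. (\<forall>j \<in> set (A ! i). E (f i) (f j)) \<and> (\<forall>j \<in> set (Q ! i). \<not> E (f i) (f j)))"

definition occurs :: "pgraph \<Rightarrow> bool" where
  "occurs S \<longleftrightarrow> (\<exists>f. realizes f S)"

lemma neighbours_full:
  assumes "realizes f (A, Q)" "wf_pgraph (A, Q)" "i < length A" "length (A ! i) = 4"
  shows "{v. E (f i) v} = f ` set (A ! i)"
proof (rule sym, rule card_subset_eq[OF finite_neighbours])
  show "f ` set (A ! i) \<subseteq> {v. E (f i) v}" using assms by auto
  have "inj_on f (set (A ! i))" by (rule inj_on_subset[of f "{..<length A}"]) (use assms in auto)
  then have "card (f ` set (A ! i)) = card (set (A ! i))" by (rule card_image)
  also have "\<dots> = 4" using assms distinct_card[of "A ! i"] by auto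
  also have "\<dots> = card {v. E (f i) v}" using assms by (subst degree) auto
  finally show "card (f ` set (A ! i)) = card {v. E (f i) v}" .
qed

lemma realizes_absent:
  assumes "realizes f (A, Q)" "wf_pgraph (A, Q)" "i < length A" "j < length A" "absent (A, Q) i j"
  shows "\<not> E (f i) (f j)"
proof -
  have inj: "inj_on f {..<length A}" using assms by simp
  have full: "\<not> E (f a) (f b)"
    if "a < length A" "b < length A" "length (A ! a) = 4" "b \<notin> set (A ! a)" for a b
  proof
    assume "E (f a) (f b)"
    then have "f b \<in> f ` set (A ! a)" using neighbours_full[OF assms(1,2) that(1,3)] by auto
    then obtain c where "c \<in> set (A ! a)" "f b = f c" by auto
    moreover have "c < length A" using assms(2) that \<open>c \<in> set (A ! a)\<close> by auto
    ultimately show False using inj that by (auto simp: inj_on_def)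
  qed
  show ?thesis using assms full[of i j] full[of j i] E_sym by auto
qed

lemma realizes_link_edge:
  assumes "realizes f (A, Q)" "i < length A" "j < length A" "i \<noteq> j" "E (f i) (f j)"
  shows "realizes f (link i j A, Q)"
  using assms by (auto simp: set_link_nth split: if_splits intro: E_sym)

lemma realizes_link_nonedge:
  assumes "realizes f (A, Q)" "length Q = length A" "i < length A" "j < length A" "i \<noteq> j"
    "\<not> E (f i) (f j)"
  shows "realizes f (A, link i j Q)"
  using assms by (auto simp: set_link_nth split: if_splits dest: E_sym)

lemma occurs_embeds:
  assumes "realizes f S" "wf_pgraph S" "wf_pgraph T" "embeds m T S"
  shows "occurs T"
proof -
  obtain A Q B R where ST: "S = (A, Q)" "T = (B, R)" by (metis surj_pair)
  note a = assms[unfolded ST]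
  let ?g = "\<lambda>i. f (m ! i)"
  have len: "length m = length B" "length R = length B" using a by auto
  have m: "m ! i < length A" if "i < length B" for i using a that len by (auto simp: set_conv_nth)
  have "inj_on ?g {..<length B}"
  proof (rule inj_onI)
    fix x y assume "x \<in> {..<length B}" "y \<in> {..<length B}" "f (m ! x) = f (m ! y)"
    then have "m ! x = m ! y" using a(1) m by (auto simp: inj_on_def)
    then show "x = y" using a len \<open>x \<in> _\<close> \<open>y \<in> _\<close> by (auto simp: nth_eq_iff_index_eq)
  qed
  moreover have "?g ` {..<length B} \<subseteq> V" using a(1) m by auto
  moreover have "E (?g i) (?g j)" if "i < length B" "j \<in> set (B ! i)" for i j
  proof -
    have "(m ! i, B ! i) \<in> set (zip m B)" using that len by (auto simp: set_zip)
    then have "m ! j \<in> set (A ! (m ! i))" using a that by auto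
    then show ?thesis using a(1) m that by auto
  qed
  moreover have "\<not> E (?g i) (?g j)" if "i < length B" "j \<in> set (R ! i)" for i j
  proof -
    have "(m ! i, R ! i) \<in> set (zip m R)" using that len by (auto simp: set_zip)
    then have "absent (A, Q) (m ! i) (m ! j)" using a that by auto
    moreover have "j < length B" using a that by auto
    ultimately show ?thesis using realizes_absent[OF a(1,2)] m that by auto
  qed
  ultimately have "realizes ?g T" using ST by auto
  then show ?thesis unfolding occurs_def by blast
qed

lemma occurs_com_children:
  assumes r: "realizes f (A, Q)" and wf: "wf_pgraph (A, Q)"
    and ij: "i < length A" "j < length A" "i \<noteq> j" "length (A ! i) = 4" "j \<notin> set (A ! i)"
    and one: "length (filter (\<lambda>k. k \<in> set (A ! j)) (A ! i)) = 1"
  shows "\<exists>T \<in> set (com_children (A, Q) i j). occurs T"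
proof -
  have inj: "inj_on f {..<length A}" using r by simp
  obtain k where k: "filter (\<lambda>k. k \<in> set (A ! j)) (A ! i) = [k]"
    using one by (metis One_nat_def length_0_conv length_Suc_conv)
  then have kset: "{x \<in> set (A ! i). x \<in> set (A ! j)} = {k}"
    by (metis set_filter list.set(1) list.simps(15))
  then have kk: "k \<in> set (A ! i)" "k \<in> set (A ! j)" by auto
  have fij: "f i \<noteq> f j" using inj ij by (auto simp: inj_on_def)
  have "absent (A, Q) i j" using ij by simp
  then have "\<not> E (f i) (f j)" by (rule realizes_absent[OF r wf ij(1,2)])
  moreover have "E (f i) (f k)" "E (f j) (f k)" using r ij kk by auto
  ultimately obtain w where w: "w \<noteq> f k" "E (f i) w" "E (f j) w"
    using second_common_neighbour[OF fij] by blast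
  then obtain l where l: "l \<in> set (A ! i)" "w = f l"
    using neighbours_full[OF r wf ij(1,4)] by auto
  have l': "l < length A" "l \<noteq> j" "l \<noteq> k" using l wf ij w by auto
  have "l \<notin> set (A ! j)" using kset l l' by auto
  moreover have "\<not> absent (A, Q) l j" using realizes_absent[OF r wf l'(1) ij(2)] w l E_sym by blast
  ultimately have "(link l j A, Q) \<in> set (com_children (A, Q) i j)" using l by auto
  moreover have "realizes f (link l j A, Q)"
    by (rule realizes_link_edge[OF r l'(1) ij(2) l'(2)]) (use w l E_sym in auto)
  ultimately show ?thesis unfolding occurs_def by blast
qed

text \<open>The hypothesis on \<open>w\<close> is relative to the remaining candidates
  \<open>js\<close>, which lets it survive the induction: a candidate not adjacent to
  \<open>f i\<close> cannot be \<open>w\<close> and may be dropped. Once none is left,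
  \<open>w\<close> lies outside the image of \<open>f\<close>.\<close>

lemma occurs_nbr_children_aux:
  assumes "realizes f (A, Q)" "wf_pgraph (A, Q)" "i < length A"
    "set js \<subseteq> {..<length A} - {i}" "E (f i) w" "w \<in> f ` {..<length A} \<Longrightarrow> w \<in> f ` set js"
  shows "\<exists>T \<in> set (nbr_children i js (A, Q)). occurs T"
  using assms
proof (induction js arbitrary: Q)
  case Nil
  let ?n = "length A" and ?g = "f(length A := w)"
  have w: "w \<in> V" "w \<notin> f ` {..<?n}" using Nil E_V by auto
  have "inj_on ?g {..<length (A @ [[]])}"
    using w Nil.prems(1) by (auto simp: inj_on_def less_Suc_eq)
  moreover have "?g ` {..<length (A @ [[]])} \<subseteq> V" using w Nil.prems(1) by (auto simp: less_Suc_eq)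
  moreover have "E (?g a) (?g b)" if "a < length (A @ [[]])" "b \<in> set ((A @ [[]]) ! a)" for a b
    using that Nil.prems(1,2) by (fastforce simp: nth_append less_Suc_eq)
  moreover have "\<not> E (?g a) (?g b)" if "a < length (A @ [[]])" "b \<in> set ((Q @ [[]]) ! a)" for a b
    using that Nil.prems(1,2) by (fastforce simp: nth_append less_Suc_eq)
  ultimately have "realizes ?g (A @ [[]], Q @ [[]])" by auto
  then have "realizes ?g (link i ?n (A @ [[]]), Q @ [[]])"
    by (rule realizes_link_edge) (use Nil.prems in auto)
  then show ?case unfolding occurs_def by (auto simp del: realizes.simps)
next
  case (Cons j js)
  show ?case
  proof (cases "E (f i) (f j)")
    case True
    have "realizes f (link i j A, Q)"
      by (rule realizes_link_edge[OF Cons.prems(1)]) (use Cons.prems True in auto)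
    then show ?thesis unfolding occurs_def by (auto simp del: realizes.simps)
  next
    case False
    have "realizes f (A, link i j Q)"
      by (rule realizes_link_nonedge[OF Cons.prems(1)]) (use Cons.prems False in auto)
    moreover have "wf_pgraph (A, link i j Q)"
      using Cons.prems by (intro wf_link_nonedge) auto
    moreover have "w \<noteq> f j" using False Cons.prems by auto
    ultimately have "\<exists>T \<in> set (nbr_children i js (A, link i j Q)). occurs T"
      using Cons.prems by (intro Cons.IH) auto
    then show ?thesis by auto
  qed
qed

lemma occurs_nbr_children:
  assumes r: "realizes f (A, Q)" and wf: "wf_pgraph (A, Q)"
    and i: "i < length A" "length (A ! i) < 4"
  shows "\<exists>T \<in> set (nbr_children i
    (filter (\<lambda>j. j \<noteq> i \<and> j \<notin> set (A ! i) \<and> \<not> absent (A, Q) i j) [0..<length A]) (A, Q)). occurs T"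
proof -
  have "card (f ` set (A ! i)) \<le> length (A ! i)"
    by (meson card_image_le card_length finite_set order_trans)
  then have "card (f ` set (A ! i)) < card {v. E (f i) v}"
    using r i by (subst degree) auto
  then have "\<not> {v. E (f i) v} \<subseteq> f ` set (A ! i)"
    by (meson card_mono finite_imageI finite_set not_le)
  then obtain w where w: "E (f i) w" "w \<notin> f ` set (A ! i)" by auto
  show ?thesis
  proof (rule occurs_nbr_children_aux[OF r wf i(1) _ w(1)])
    assume "w \<in> f ` {..<length A}"
    then obtain j where j: "j < length A" "w = f j" by auto
    moreover have "j \<noteq> i" using w E_irrefl j by auto
    moreover have "\<not> absent (A, Q) i j" using realizes_absent[OF r wf i(1) j(1)] w j by auto
    ultimately show "w \<in> f ` set (filter (\<lambda>j. j \<noteq> i \<and> j \<notin> set (A ! i) \<and> \<not> absent (A, Q) i j)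
        [0..<length A])" using w by auto
  qed auto
qed

definition avoided :: "pgraph \<Rightarrow> bool" where
  "avoided S \<longleftrightarrow> wf_pgraph S \<and> \<not> occurs S"

text \<open>Were \<open>S\<close> to occur, one of its children would occur, or the excluded graph
  embedded in it. The invariant that all recorded graphs are avoided passes from \<open>K\<close> to
  \<open>K'\<close>.\<close>

lemma check_sound:
  "check K S c = Some K' \<Longrightarrow> wf_pgraph S \<Longrightarrow> \<forall>(x, T) \<in> set K. avoided T \<Longrightarrow>
     avoided S \<and> (\<forall>(x, T) \<in> set K'. avoided T)"
  "check_list K Ss cs = Some K' \<Longrightarrow> \<forall>S \<in> set Ss. wf_pgraph S \<Longrightarrow> \<forall>(x, T) \<in> set K. avoided T \<Longrightarrow>
     (\<forall>S \<in> set Ss. avoided S) \<and> (\<forall>(x, T) \<in> set K'. avoided T)"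
proof (induction K S c and K Ss cs arbitrary: K' and K' rule: check_check_list.induct)
  case (1 K S x m)
  then obtain T where "map_of K x = Some T" "embeds m T S" "K' = K"
    by (auto split: option.splits if_splits)
  moreover from this have "avoided T" using 1 map_of_SomeD by fastforce
  ultimately show ?case using 1 occurs_embeds unfolding avoided_def occurs_def by blast
next
  case (2 K A Q i j cs)
  then have c: "i < length A" "j < length A" "i \<noteq> j" "length (A ! i) = 4" "j \<notin> set (A ! i)"
    "length (filter (\<lambda>k. k \<in> set (A ! j)) (A ! i)) = 1"
    "check_list K (com_children (A, Q) i j) cs = Some K'"
    by (auto split: if_splits)
  have "\<forall>S \<in> set (com_children (A, Q) i j). wf_pgraph S"
    using wf_com_children[OF 2(3) c(1,2,5)] by blast
  from 2(1)[OF _ c(7) this 2(4)] c(1-6)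
  have "\<forall>S \<in> set (com_children (A, Q) i j). avoided S" "\<forall>(x, T) \<in> set K'. avoided T" by blast+
  then show ?case
    using occurs_com_children[OF _ 2(3) c(1-6)] 2(3) unfolding avoided_def occurs_def by blast
next
  case (3 K A Q i cs)
  let ?U = "filter (\<lambda>j. j \<noteq> i \<and> j \<notin> set (A ! i) \<and> \<not> absent (A, Q) i j) [0..<length A]"
  from 3 have c: "i < length A" "length (A ! i) < 4"
    "check_list K (nbr_children i ?U (A, Q)) cs = Some K'"
    by (auto split: if_splits)
  have "set ?U \<subseteq> {..<length A} - {i}" by auto
  then have "\<forall>S \<in> set (nbr_children i ?U (A, Q)). wf_pgraph S"
    using wf_nbr_children[OF 3(3) c(1)] by blast
  from 3(1)[OF _ c(3) this 3(4)] c(1,2)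
  have "\<forall>S \<in> set (nbr_children i ?U (A, Q)). avoided S" "\<forall>(x, T) \<in> set K'. avoided T" by blast+
  then show ?case
    using occurs_nbr_children[OF _ 3(3) c(1,2)] 3(3) unfolding avoided_def occurs_def by blast
next
  case (4 K S x c)
  from 4(2) obtain K'' where k: "check K S c = Some K''" "K' = (x, S) # K''"
    by (auto split: option.splits)
  from 4(1)[OF k(1) 4(3,4)] k(2) show ?case by simp
next
  case (6 K S Ss c cs)
  from 6(3) obtain K'' where k: "check K S c = Some K''" "check_list K'' Ss cs = Some K'"
    by (auto split: option.splits)
  from 6(4) have wf: "wf_pgraph S" "\<forall>S \<in> set Ss. wf_pgraph S" by simp_all
  from 6(1)[OF k(1) wf(1) 6(5)] have S: "avoided S" "\<forall>(x, T) \<in> set K''. avoided T" by blast+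
  from 6(2)[OF k(1) k(2) wf(2) S(2)] S(1) show ?case by simp
next
  case (5 K)
  then show ?case by simp
next
  case ("7_1" K c cs)
  from "7_1"(1) show ?case by simp
next
  case ("7_2" K S Ss)
  from "7_2"(1) show ?case by simp
qed

section \<open>Chains of twin pairs\<close>

definition chain :: "(nat \<Rightarrow> 'a set) \<Rightarrow> nat \<Rightarrow> bool" where
  "chain P N \<longleftrightarrow> (\<forall>p<N. card (P p) = 2 \<and> P p \<subseteq> V) \<and>
     (\<forall>p<N. \<forall>q<N. p \<noteq> q \<longrightarrow> P p \<inter> P q = {}) \<and>
     (\<forall>p. Suc p < N \<longrightarrow> (\<forall>x \<in> P p. \<forall>y \<in> P (Suc p). E x y))"

lemma chain_disjoint: "chain P N \<Longrightarrow> p < N \<Longrightarrow> q < N \<Longrightarrow> x \<in> P p \<Longrightarrow> x \<in> P q \<Longrightarrow> p = q"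
  unfolding chain_def by blast

lemma chain_in_V: "chain P N \<Longrightarrow> p < N \<Longrightarrow> x \<in> P p \<Longrightarrow> x \<in> V"
  unfolding chain_def by blast

lemma chain_E: "chain P N \<Longrightarrow> Suc p < N \<Longrightarrow> x \<in> P p \<Longrightarrow> y \<in> P (Suc p) \<Longrightarrow> E x y"
  unfolding chain_def by blast

lemma chain_card: "chain P N \<Longrightarrow> p < N \<Longrightarrow> card (P p) = 2"
  unfolding chain_def by blast

lemma neighbours_union:
  assumes "u \<in> V" "card A = 2" "card B = 2" "A \<inter> B = {}" "\<And>v. v \<in> A \<union> B \<Longrightarrow> E u v"
  shows "E u v \<longleftrightarrow> v \<in> A \<union> B"
proof -
  have "finite A" "finite B" using assms by (metis card.infinite zero_neq_numeral)+
  then have "card (A \<union> B) = 4" using assms by (simp add: card_Un_disjoint)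
  then have "A \<union> B = {v. E u v}"
    by (intro card_subset_eq finite_neighbours) (use assms degree in auto)
  then show ?thesis by auto
qed

text \<open>The two adjacent pairs already supply four neighbours. In particular an inner pair is
  independent, although \<open>chain\<close> does not ask for it.\<close>

lemma chain_inner:
  assumes "chain P N" "Suc (Suc p) < N" "x \<in> P (Suc p)"
  shows "E x y \<longleftrightarrow> y \<in> P p \<union> P (Suc (Suc p))"
proof (rule neighbours_union)
  show "x \<in> V" using chain_in_V[OF assms(1), of "Suc p"] assms by simp
  show "card (P p) = 2" "card (P (Suc (Suc p))) = 2" "P p \<inter> P (Suc (Suc p)) = {}"
    using assms unfolding chain_def by auto
  show "E x v" if "v \<in> P p \<union> P (Suc (Suc p))" for v
    using that assms E_sym[OF chain_E[OF assms(1), of p v x]] chain_E[OF assms(1), of "Suc p" x v]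
    by auto
qed

lemma chain_rev:
  assumes "chain P N"
  shows "chain (\<lambda>p. P (N - 1 - p)) N"
proof -
  have "E x y" if "Suc p < N" "x \<in> P (N - 1 - p)" "y \<in> P (N - 1 - Suc p)" for p x y
  proof -
    have "N - 1 - p = Suc (N - 1 - Suc p)" "Suc (N - 1 - Suc p) < N" using that by auto
    with assms that show ?thesis unfolding chain_def by (metis E_sym)
  qed
  moreover have "P (N - 1 - p) \<inter> P (N - 1 - q) = {}" if "p < N" "q < N" "p \<noteq> q" for p q
  proof -
    have "N - 1 - p < N" "N - 1 - q < N" "N - 1 - p \<noteq> N - 1 - q" using that by auto
    with assms show ?thesis unfolding chain_def by blast
  qed
  ultimately show ?thesis using assms unfolding chain_def by auto
qed

text \<open>A vertex \<open>p\<close> of the last pair but one is not adjacent to \<open>x\<close>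
  but shares \<open>e\<close> with it, so they share some other \<open>w\<close>. The neighbours of
  \<open>p\<close> are \<open>P (n + 2)\<close>, \<open>e\<close> and \<open>f\<close>, and the
  saturated inner pairs rule out \<open>P (n + 2)\<close>, which leaves
  \<open>w = f\<close>.\<close>

lemma chain_last_twins:
  assumes ch: "chain P (n + 5)" and ef: "e \<in> P (n + 4)" "f \<in> P (n + 4)" "e \<noteq> f"
    and x: "E e x" "x \<notin> P (n + 3)" "x \<noteq> f"
  shows "E f x"
proof -
  have "card (P (n + 4)) = 2" using chain_card[OF ch] by simp
  then have last: "P (n + 4) = {e, f}"
    using ef by (metis card_2_iff doubleton_eq_iff insertE singletonD)
  have N1: "E z y \<longleftrightarrow> y \<in> P n \<union> P (n + 2)" if "z \<in> P (n + 1)" for y z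
    using chain_inner[OF ch, of n z y] that by simp
  have N2: "E z y \<longleftrightarrow> y \<in> P (n + 1) \<union> P (n + 3)" if "z \<in> P (n + 2)" for y z
    using chain_inner[OF ch, of "n + 1" z y] that by (simp add: eval_nat_numeral)
  have N3: "E z y \<longleftrightarrow> y \<in> P (n + 2) \<union> P (n + 4)" if "z \<in> P (n + 3)" for y z
    using chain_inner[OF ch, of "n + 2" z y] that by (simp add: eval_nat_numeral)
  have dis: "e \<notin> P n" "e \<notin> P (n + 1)" "e \<notin> P (n + 2)" "e \<notin> P (n + 3)"
    using chain_disjoint[OF ch _ _ ef(1), of "n"]
      chain_disjoint[OF ch _ _ ef(1), of "n + 1"]
      chain_disjoint[OF ch _ _ ef(1), of "n + 2"]
      chain_disjoint[OF ch _ _ ef(1), of "n + 3"] by auto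
  have "P (n + 3) \<noteq> {}" using chain_card[OF ch, of "n + 3"] by auto
  then obtain p where p: "p \<in> P (n + 3)" by auto
  have "E p e" using N3[OF p] ef by auto
  moreover have "\<not> E p x"
  proof
    assume "E p x"
    then have "x \<in> P (n + 2)" using N3[OF p] last x E_irrefl by auto
    then show False using N2[of x e] x dis E_sym by auto
  qed
  moreover have "p \<noteq> x" using p x by auto
  ultimately obtain w where w: "w \<noteq> e" "E p w" "E x w"
    using second_common_neighbour[of p x e] E_sym[OF x(1)] by auto
  have "w \<notin> P (n + 2)"
  proof
    assume "w \<in> P (n + 2)"
    then have "x \<in> P (n + 1)" using N2[of w x] E_sym[OF w(3)] x by auto
    then show False using N1[of x e] x dis E_sym by auto
  qed
  then have "w = f" using N3[OF p] w last by auto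
  then show ?thesis using w E_sym by auto
qed

text \<open>If \<open>e\<close> and \<open>f\<close> were adjacent, both would have a single further
  neighbour, by the twin property the same \<open>x\<close>. Another neighbour \<open>y\<close> of
  \<open>x\<close> shares \<open>x\<close> with \<open>e\<close> but nothing else: \<open>f\<close>
  is saturated without \<open>y\<close>, and a common neighbour in \<open>P (n + 3)\<close> would
  put \<open>y\<close> into \<open>P (n + 2)\<close>, whose neighbourhood does not contain
  \<open>x\<close>.\<close>

lemma chain_last_independent:
  assumes ch: "chain P (n + 5)" and ef: "e \<in> P (n + 4)" "f \<in> P (n + 4)"
  shows "\<not> E e f"
proof
  assume e: "E e f"
  then have nef: "e \<noteq> f" using E_irrefl by auto
  have N1: "E z y \<longleftrightarrow> y \<in> P n \<union> P (n + 2)" if "z \<in> P (n + 1)" for y z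
    using chain_inner[OF ch, of n z y] that by simp
  have N2: "E z y \<longleftrightarrow> y \<in> P (n + 1) \<union> P (n + 3)" if "z \<in> P (n + 2)" for y z
    using chain_inner[OF ch, of "n + 1" z y] that by (simp add: eval_nat_numeral)
  have N3: "E z y \<longleftrightarrow> y \<in> P (n + 2) \<union> P (n + 4)" if "z \<in> P (n + 3)" for y z
    using chain_inner[OF ch, of "n + 2" z y] that by (simp add: eval_nat_numeral)
  have dis: "z \<notin> P n \<and> z \<notin> P (n + 1) \<and> z \<notin> P (n + 2) \<and> z \<notin> P (n + 3)" if "z \<in> P (n + 4)" for z
    using chain_disjoint[OF ch _ _ that, of "n"]
      chain_disjoint[OF ch _ _ that, of "n + 1"]
      chain_disjoint[OF ch _ _ that, of "n + 2"]
      chain_disjoint[OF ch _ _ that, of "n + 3"] by auto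
  have eV: "e \<in> V" "f \<in> V" using chain_in_V[OF ch, of "n + 4"] ef by auto
  have c3: "card (P (n + 3)) = 2" and c4: "card (P (n + 4)) = 2"
    using ch unfolding chain_def by auto
  have fin: "finite (P (n + 3))" using c3 by (metis card.infinite zero_neq_numeral)
  have last: "P (n + 4) = {e, f}" using c4 ef nef by (metis card_2_iff doubleton_eq_iff insertE singletonD)
  have p3: "E e p" "E f p" if "p \<in> P (n + 3)" for p using N3[OF that] ef E_sym by blast+
  have fP: "f \<notin> P (n + 3)" "e \<notin> P (n + 3)" using dis ef by auto
  have "card (insert f (P (n + 3))) = 3" using c3 fin fP by simp
  then have "\<not> {v. E e v} \<subseteq> insert f (P (n + 3))"
    using degree[OF eV(1)] card_mono[of "insert f (P (n + 3))" "{v. E e v}"] fin by auto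
  then obtain x where x: "E e x" "x \<noteq> f" "x \<notin> P (n + 3)" by auto
  have fx: "E f x" by (rule chain_last_twins[OF ch ef nef x(1,3,2)])
  have xe: "x \<noteq> e" using x E_irrefl by auto
  have Ne: "E e v \<longleftrightarrow> v \<in> P (n + 3) \<union> {f, x}" for v
    by (rule neighbours_union[OF eV(1) c3]) (use x fP p3 e in auto)
  have Nf: "E f v \<longleftrightarrow> v \<in> P (n + 3) \<union> {e, x}" for v
    by (rule neighbours_union[OF eV(2) c3]) (use x fP p3 E_sym[OF e] fx xe in auto)
  have xV: "x \<in> V" using E_V x by auto
  have x_not: "x \<notin> P (n + 1)" "x \<notin> P (n + 2)"
    using N1[of x e] N2[of x e] dis[OF ef(1)] E_sym[OF x(1)] by auto
  have "\<not> {v. E x v} \<subseteq> {e, f}"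
    using degree[OF xV] card_mono[of "{e, f}" "{v. E x v}"] nef by auto
  then obtain y where y: "E x y" "y \<noteq> e" "y \<noteq> f" by auto
  have yx: "y \<noteq> x" using y E_irrefl by auto
  have yP: "y \<notin> P (n + 3)"
    using N3[of y x] E_sym[OF y(1)] x_not xe x last by auto
  have "\<not> E e y" using Ne y yP yx by auto
  then obtain w where w: "w \<noteq> x" "E e w" "E y w"
    using second_common_neighbour[of e y x] x y E_sym by blast
  have "w \<noteq> f" using w Nf y yP yx E_sym by auto
  then have "w \<in> P (n + 3)" using Ne w by auto
  then have "y \<in> P (n + 2)" using N3[of w y] E_sym[OF w(3)] last y by auto
  then have "x \<in> P (n + 1) \<union> P (n + 3)" using N2[of y x] E_sym[OF y(1)] by auto
  then show False using x x_not by auto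
qed

definition closed_chain :: "(nat \<Rightarrow> 'a set) \<Rightarrow> nat \<Rightarrow> bool" where
  "closed_chain P N \<longleftrightarrow> chain P N \<and> (\<forall>x \<in> P (N - 1). \<forall>y \<in> P 0. E x y)"

text \<open>The two remaining neighbours of \<open>e\<close> form a set \<open>Q\<close>, and
  \<open>f\<close> is adjacent to both. As inner pairs are saturated, \<open>Q\<close> can meet only
  the first pair; it is either disjoint from it, and then prolongs the chain, or equal to
  it.\<close>

lemma chain_extends_or_closes:
  assumes ch: "chain P (n + 5)"
  shows "closed_chain P (n + 5) \<or> (\<exists>Q. chain (P(n + 5 := Q)) (n + 6))"
proof -
  obtain e f where last: "P (n + 4) = {e, f}" and nef: "e \<noteq> f"
    using chain_card[OF ch, of "n + 4"] by (auto simp: card_2_iff)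
  obtain u u' where first: "P 0 = {u, u'}" and nu: "u \<noteq> u'"
    using chain_card[OF ch, of 0] by (auto simp: card_2_iff)
  have ef: "e \<in> P (n + 4)" "f \<in> P (n + 4)" using last by auto
  have N3: "E z y \<longleftrightarrow> y \<in> P (n + 2) \<union> P (n + 4)" if "z \<in> P (n + 3)" for y z
    using chain_inner[OF ch, of "n + 2" z y] that by (simp add: eval_nat_numeral)
  have eV: "e \<in> V" "f \<in> V" using chain_in_V[OF ch, of "n + 4"] ef by auto
  have c3: "card (P (n + 3)) = 2" using ch unfolding chain_def by auto
  have fin: "finite (P (n + 3))" using c3 by (metis card.infinite zero_neq_numeral)
  have p3: "E e p" "E f p" if "p \<in> P (n + 3)" for p using N3[OF that] ef E_sym by blast+
  define Q where "Q = {v. E e v} - P (n + 3)"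
  have sub: "P (n + 3) \<subseteq> {v. E e v}" using p3 by auto
  have cQ: "card Q = 2"
    unfolding Q_def using card_Diff_subset[OF fin sub] degree[OF eV(1)] c3 by simp
  have Qf: "E f x" if "x \<in> Q" for x
  proof -
    have "x \<noteq> f" using that chain_last_independent[OF ch ef] unfolding Q_def by auto
    then show ?thesis using chain_last_twins[OF ch ef nef] that unfolding Q_def by auto
  qed
  have QE: "E x y" if "x \<in> P (n + 4)" "y \<in> Q" for x y
    using that Qf last unfolding Q_def by auto
  have Q_not: "x \<notin> P p" if "x \<in> Q" "0 < p" "p < n + 5" for x p
  proof
    assume xp: "x \<in> P p"
    show False
    proof (cases "p = n + 4")
      case True
      then show False using xp that(1) chain_last_independent[OF ch ef(1)] unfolding Q_def by auto
    next
      case False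
      from \<open>0 < p\<close> obtain q where q: "p = Suc q" using gr0_implies_Suc by blast
      then have "E x e \<longleftrightarrow> e \<in> P q \<union> P (Suc (Suc q))"
        using chain_inner[OF ch, of q x e] xp that False by auto
      moreover have "E x e" using that(1) E_sym unfolding Q_def by auto
      ultimately consider "e \<in> P q" | "e \<in> P (Suc (Suc q))" by auto
      then have "p = n + 3"
      proof cases
        case 1
        then have "q = n + 4" using chain_disjoint[OF ch _ _ _ ef(1)] that q by auto
        then show ?thesis using that q by auto
      next
        case 2
        then have "Suc (Suc q) = n + 4" using chain_disjoint[OF ch _ _ _ ef(1)] that q False by auto
        then show ?thesis using q by auto
      qed
      then show False using xp that(1) unfolding Q_def by auto
    qed
  qed
  show ?thesis
  proof (cases "Q \<inter> P 0 = {}")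
    case True
    then have Q0: "x \<notin> P p" if "x \<in> Q" "p < n + 5" for x p
      using Q_not that by (cases "p = 0") auto
    have dis: "P p \<inter> Q = {}" if "p < n + 5" for p using Q0 that by auto
    have "Q \<subseteq> V" unfolding Q_def using E_V by auto
    have E': "E x y" if "Suc p < n + 6" "x \<in> (P(n + 5 := Q)) p" "y \<in> (P(n + 5 := Q)) (Suc p)" for p x y
    proof (cases "p = n + 4")
      case True
      then show ?thesis using QE that by auto
    next
      case False
      then have "Suc p < n + 5" using that by auto
      then show ?thesis using chain_E[OF ch, of p x y] that by auto
    qed
    have dis': "(P(n + 5 := Q)) p \<inter> (P(n + 5 := Q)) q = {}" if "p < n + 6" "q < n + 6" "p \<noteq> q" for p q
    proof -
      have "p < n + 5 \<or> p = n + 5" "q < n + 5 \<or> q = n + 5" using that by auto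
      then show ?thesis using that dis ch unfolding chain_def by (auto simp: Int_commute)
    qed
    have card': "card ((P(n + 5 := Q)) p) = 2 \<and> (P(n + 5 := Q)) p \<subseteq> V" if "p < n + 6" for p
    proof -
      have "p < n + 5 \<or> p = n + 5" using that by auto
      then show ?thesis using ch cQ \<open>Q \<subseteq> V\<close> unfolding chain_def by auto
    qed
    have "chain (P(n + 5 := Q)) (n + 6)"
      unfolding chain_def using card' dis' E' by blast
    then show ?thesis by blast
  next
    case False
    then obtain v where v: "v \<in> Q" "v \<in> P 0" by auto
    \<comment> \<open>In the reversed chain \<open>P 0\<close> is the last pair, so the twin
      property transfers the edge from \<open>v\<close> to \<open>e\<close> to the other vertex of
      \<open>P 0\<close>.\<close>
    have rev: "chain (\<lambda>p. P (n + 4 - p)) (n + 5)"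
      using chain_rev[OF ch] by (simp add: add.commute)
    have all: "x \<in> Q" if "x \<in> P 0" for x
    proof (cases "x = v")
      case True
      then show ?thesis using v by simp
    next
      case False
      have "e \<notin> P 1" "e \<noteq> x" using chain_disjoint[OF ch _ _ ef(1), of 1]
          chain_disjoint[OF ch _ _ ef(1), of 0] that by auto
      then have "E x e"
        using chain_last_twins[OF rev, of v x e] v that False E_sym unfolding Q_def by auto
      then have "E e x" using E_sym by auto
      moreover have "x \<notin> P (n + 3)" using chain_disjoint[OF ch _ _ that, of "n + 3"] by auto
      ultimately show ?thesis unfolding Q_def by auto
    qed
    then show ?thesis using ch QE unfolding closed_chain_def by (simp add: add.commute)
  qed
qed

lemma chain_closes:
  assumes "chain P (n + 5)"
  shows "\<exists>N \<ge> 5. \<exists>P. closed_chain P N"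
proof (rule ccontr)
  assume no: "\<not> ?thesis"
  have "\<exists>P. chain P (n + 5 + m)" for m
  proof (induction m)
    case 0
    then show ?case using assms by auto
  next
    case (Suc m)
    then obtain P where "chain P ((n + m) + 5)" by (auto simp: ac_simps)
    from chain_extends_or_closes[OF this] no obtain Q where "chain (P(n + m + 5 := Q)) (n + m + 6)"
      by (meson le_add2)
    moreover have "n + m + 6 = n + 5 + Suc m" by simp
    ultimately show ?case by metis
  qed
  \<comment> \<open>More than \<open>card V\<close> disjoint pairs cannot fit into
    \<open>V\<close>.\<close>
  then obtain P where P: "chain P (n + 5 + card V)" by blast
  let ?N = "n + 5 + card V"
  have "card (\<Union>p<?N. P p) = (\<Sum>p<?N. card (P p))"
  proof (rule card_UN_disjoint)
    show "\<forall>i \<in> {..<?N}. finite (P i)" using P finite_V unfolding chain_def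
      by (meson finite_subset lessThan_iff)
    show "\<forall>i \<in> {..<?N}. \<forall>j \<in> {..<?N}. i \<noteq> j \<longrightarrow> P i \<inter> P j = {}" using P unfolding chain_def by auto
  qed simp
  also have "\<dots> = 2 * ?N" using P unfolding chain_def by simp
  finally have "2 * ?N \<le> card V"
    using card_mono[OF finite_V, of "\<Union>p<?N. P p"] P unfolding chain_def by (simp add: UN_subset_iff)
  then show False by simp
qed

text \<open>Adding \<open>N - 1\<close> modulo \<open>N\<close> is the cyclic predecessor on natural
  numbers. With \<open>3 \<le> N\<close> it differs from the successor, so the two pairs contain
  four vertices.\<close>

lemma closed_chain_adjacent:
  assumes cl: "closed_chain P N" and N: "3 \<le> N" and p: "p < N" and x: "x \<in> P p"
  shows "E x y \<longleftrightarrow> y \<in> P ((p + 1) mod N) \<union> P ((p + (N - 1)) mod N)"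
proof (rule neighbours_union)
  have ch: "chain P N" and close: "\<And>x y. x \<in> P (N - 1) \<Longrightarrow> y \<in> P 0 \<Longrightarrow> E x y"
    using cl unfolding closed_chain_def by auto
  have step: "E x y" if "q < N" "x \<in> P q" "y \<in> P ((q + 1) mod N)" for q x y
  proof (cases "Suc q < N")
    case True
    then show ?thesis using chain_E[OF ch True] that by simp
  next
    case False
    then have "q = N - 1" "Suc q = N" using that by auto
    then show ?thesis using close that by simp
  qed
  have lt: "(p + 1) mod N < N" "(p + (N - 1)) mod N < N" using N by simp_all
  show "x \<in> V" using chain_in_V[OF ch p x] .
  show "card (P ((p + 1) mod N)) = 2" "card (P ((p + (N - 1)) mod N)) = 2"
    using chain_card[OF ch] lt by auto
  have succ_pred: "((p + (N - 1)) mod N + 1) mod N = p"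
    using N p by (simp add: mod_Suc_eq)
  have "(p + 1) mod N \<noteq> (p + (N - 1)) mod N"
  proof (cases "p = 0")
    case True
    then show ?thesis using N by simp
  next
    case False
    then have "(p + (N - 1)) mod N = p - 1" using N p by (simp add: mod_if)
    then show ?thesis using N p False by (cases "p + 1 = N") auto
  qed
  then show "P ((p + 1) mod N) \<inter> P ((p + (N - 1)) mod N) = {}"
    using ch lt unfolding chain_def by blast
  show "E x v" if "v \<in> P ((p + 1) mod N) \<union> P ((p + (N - 1)) mod N)" for v
    using that step[OF p x] E_sym[OF step[OF lt(2), of v x]] x succ_pred by auto
qed

lemma closed_chain_cover:
  assumes cl: "closed_chain P N" and N: "3 \<le> N"
  shows "(\<Union>p<N. P p) = V"
proof (rule connectedness)
  have ch: "chain P N" using cl unfolding closed_chain_def by auto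
  show "(\<Union>p<N. P p) \<subseteq> V" using chain_in_V[OF ch] by auto
  have "P 0 \<noteq> {}" using chain_card[OF ch, of 0] N by auto
  then show "(\<Union>p<N. P p) \<noteq> {}" using N by force
  fix u v assume "u \<in> (\<Union>p<N. P p)" "E u v"
  then obtain p where "p < N" "v \<in> P ((p + 1) mod N) \<union> P ((p + (N - 1)) mod N)"
    using closed_chain_adjacent[OF cl N] by blast
  moreover have "(p + 1) mod N < N" "(p + (N - 1)) mod N < N" using N by simp_all
  ultimately show "v \<in> (\<Union>p<N. P p)" by blast
qed

text \<open>Pair \<open>p\<close> receives the labels \<open>2 * p\<close> and
  \<open>2 * p + 1\<close>. The graph is the lexicographic product of a cycle of length
  \<open>N\<close> with two isolated vertices.\<close>

lemma closed_chain_labelling: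
  assumes cl: "closed_chain P N" and N: "3 \<le> N"
  shows "\<exists>c. bij_betw c {..<2 * N} V \<and> (\<forall>i<2 * N. \<forall>j<2 * N. E (c i) (c j) \<longleftrightarrow>
    j div 2 = (i div 2 + 1) mod N \<or> j div 2 = (i div 2 + (N - 1)) mod N)"
proof -
  have ch: "chain P N" using cl unfolding closed_chain_def by auto
  have "\<exists>a b. P p = {a, b} \<and> a \<noteq> b" if "p < N" for p
    using chain_card[OF ch that] by (auto simp: card_2_iff)
  then obtain a b where ab: "\<And>p. p < N \<Longrightarrow> P p = {a p, b p} \<and> a p \<noteq> b p" by metis
  define c where "c i = (if even i then a (i div 2) else b (i div 2))" for i
  have cP: "c i \<in> P (i div 2)" if "i < 2 * N" for i
    using ab[of "i div 2"] that by (auto simp: c_def)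
  have in_P: "c i \<in> P q \<longleftrightarrow> i div 2 = q" if "i < 2 * N" "q < N" for i q
  proof -
    have "i div 2 < N" using that by auto
    then show ?thesis using chain_disjoint[OF ch _ that(2) cP[OF that(1)]] cP[OF that(1)] by blast
  qed
  have inj: "inj_on c {..<2 * N}"
  proof (rule inj_onI)
    fix i j assume ij: "i \<in> {..<2 * N}" "j \<in> {..<2 * N}" "c i = c j"
    then have j2: "j div 2 < N" by auto
    then have d: "i div 2 = j div 2" using in_P[of i "j div 2"] cP[of j] ij by simp
    have "even i \<longleftrightarrow> even j" using ab[OF j2] ij(3) d by (auto simp: c_def split: if_splits)
    with d show "i = j" by (metis even_iff_mod_2_eq_zero mod_div_mult_eq not_mod_2_eq_1_eq_0)
  qed
  have "c ` {..<2 * N} = V"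
  proof
    show "c ` {..<2 * N} \<subseteq> V"
    proof
      fix v assume "v \<in> c ` {..<2 * N}"
      then obtain i where i: "i < 2 * N" "v = c i" by auto
      then have "i div 2 < N" by auto
      then show "v \<in> V" using chain_in_V[OF ch _ cP[OF i(1)]] i(2) by simp
    qed
    show "V \<subseteq> c ` {..<2 * N}"
    proof
      fix v assume "v \<in> V"
      then obtain p where p: "p < N" "v \<in> P p" using closed_chain_cover[OF cl N] by auto
      then have "v = c (2 * p) \<or> v = c (2 * p + 1)" using ab[OF p(1)] by (auto simp: c_def)
      then show "v \<in> c ` {..<2 * N}" using p by auto
    qed
  qed
  moreover have "E (c i) (c j) \<longleftrightarrow>
      j div 2 = (i div 2 + 1) mod N \<or> j div 2 = (i div 2 + (N - 1)) mod N"
    if "i < 2 * N" "j < 2 * N" for i j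
  proof -
    have "i div 2 < N" "(i div 2 + 1) mod N < N" "(i div 2 + (N - 1)) mod N < N"
      using that N by auto
    then show ?thesis
      using closed_chain_adjacent[OF cl N _ cP[OF that(1)], of "c j"] in_P[OF that(2)] by simp
  qed
  ultimately show ?thesis using inj unfolding bij_betw_def by blast
qed

text \<open>With all neighbourhoods complete, the image of the realization is closed under
  adjacency, so connectedness makes it the whole graph.\<close>

lemma occurs_full:
  assumes occ: "occurs (A, Q)" and wf: "wf_pgraph (A, Q)" and ne: "A \<noteq> []"
    and full: "\<forall>i < length A. length (A ! i) = 4"
  shows "\<exists>f. bij_betw f {..<length A} V \<and>
    (\<forall>i < length A. \<forall>j < length A. E (f i) (f j) \<longleftrightarrow> j \<in> set (A ! i))"
proof -
  obtain f where r: "realizes f (A, Q)" using occ unfolding occurs_def by blast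
  have nb: "{v. E (f i) v} = f ` set (A ! i)" if "i < length A" for i
    using neighbours_full[OF r wf that] full that by auto
  have inj: "inj_on f {..<length A}" and sub: "f ` {..<length A} \<subseteq> V" using r by auto
  have lt: "set (A ! i) \<subseteq> {..<length A}" if "i < length A" for i using wf that by auto
  have "f ` {..<length A} = V"
  proof (rule connectedness[OF sub])
    show "f ` {..<length A} \<noteq> {}" using ne by auto
    fix u v assume "u \<in> f ` {..<length A}" "E u v"
    then show "v \<in> f ` {..<length A}" using nb lt by blast
  qed
  moreover have "E (f i) (f j) \<longleftrightarrow> j \<in> set (A ! i)" if "i < length A" "j < length A" for i j
  proof -
    have "E (f i) (f j) \<longleftrightarrow> f j \<in> f ` set (A ! i)" using nb[OF that(1)] by blast
    also have "\<dots> \<longleftrightarrow> j \<in> set (A ! i)"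
      using inj_on_image_mem_iff[OF inj _ lt[OF that(1)]] that(2) by auto
    finally show ?thesis .
  qed
  ultimately show ?thesis using inj unfolding bij_betw_def by blast
qed

end

section \<open>The search\<close>

text \<open>
  The first 15 graphs are those listed in the theorem, in its order; then come the candles
  \<open>H\<^sub>3, H\<^sub>4, H\<^sub>5\<close>. The last five satisfy the common neighbour condition but have no matrix with
  two distinct eigenvalues.
\<close>

definition finals :: "nat list list list" where
  "finals = [
     [[1, 2, 3, 4], [0, 2, 3, 4], [0, 1, 3, 4], [0, 1, 2, 4], [0, 1, 2, 3]],
     [[1, 2, 3, 4], [0, 2, 3, 5], [0, 1, 4, 6], [0, 1, 5, 6], [0, 2, 5, 6], [1, 3, 4, 6], [2, 3,
     4, 5]],
     [[1, 2, 3, 4], [0, 2, 3, 5], [0, 1, 6, 7], [0, 1, 6, 7], [0, 5, 6, 7], [1, 4, 6, 7], [2, 3,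
     4, 5], [2, 3, 4, 5]],
     [[1, 2, 3, 4], [0, 2, 3, 5], [0, 1, 4, 6], [0, 1, 6, 7], [0, 2, 5, 7], [1, 4, 6, 7], [2, 3,
     5, 7], [3, 4, 5, 6]],
     [[1, 2, 3, 4], [0, 2, 3, 4], [0, 1, 5, 6], [0, 1, 5, 7], [0, 1, 6, 7], [2, 3, 6, 7], [2, 4,
     5, 7], [3, 4, 5, 6]],
     [[1, 2, 3, 4], [0, 2, 3, 5], [0, 1, 3, 6], [0, 1, 2, 7], [0, 5, 6, 7], [1, 4, 6, 7], [2, 4,
     5, 7], [3, 4, 5, 6]],
     [[1, 2, 3, 4], [0, 2, 3, 5], [0, 1, 4, 6], [0, 1, 5, 7], [0, 2, 6, 7], [1, 3, 6, 7], [2, 4,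
     5, 7], [3, 4, 5, 6]],
     [[1, 2, 3, 4], [0, 2, 5, 6], [0, 1, 7, 8], [0, 5, 7, 9], [0, 6, 8, 9], [1, 3, 7, 10], [1, 4,
     8, 10], [2, 3, 5, 11], [2, 4, 6, 11], [3, 4, 10, 11], [5, 6, 9, 11], [7, 8, 9, 10]],
     [[1, 2, 3, 4], [0, 5, 6, 7], [0, 5, 6, 8], [0, 5, 6, 9], [0, 7, 8, 9], [1, 2, 3, 10], [1, 2,
     3, 11], [1, 4, 10, 11], [2, 4, 10, 11], [3, 4, 10, 11], [5, 7, 8, 9], [6, 7, 8, 9]],
     [[1, 2, 3, 4], [0, 2, 5, 6], [0, 1, 7, 8], [0, 4, 5, 7], [0, 3, 6, 8], [1, 3, 8, 9], [1, 4,
     7, 9], [2, 3, 6, 9], [2, 4, 5, 9], [5, 6, 7, 8]],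
     [[1, 2, 3, 4], [0, 2, 3, 4], [0, 1, 5, 6], [0, 1, 5, 7], [0, 1, 6, 7], [2, 3, 8, 9], [2, 4,
     8, 9], [3, 4, 8, 9], [5, 6, 7, 9], [5, 6, 7, 8]],
     [[1, 2, 3, 4], [0, 5, 6, 7], [0, 5, 6, 8], [0, 5, 7, 8], [0, 6, 7, 8], [1, 2, 3, 9], [1, 2,
     4, 9], [1, 3, 4, 9], [2, 3, 4, 9], [5, 6, 7, 8]],
     [[1, 2, 3, 4], [0, 5, 6, 7], [0, 5, 6, 8], [0, 5, 7, 9], [0, 6, 8, 9], [1, 2, 3, 10], [1, 2,
     4, 11], [1, 3, 10, 11], [2, 4, 10, 11], [3, 4, 10, 11], [5, 7, 8, 9], [6, 7, 8, 9]],
     [[1, 2, 3, 4], [0, 5, 6, 7], [0, 5, 8, 9], [0, 6, 8, 10], [0, 7, 9, 10], [1, 2, 11, 12], [1,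
     3, 11, 13], [1, 4, 12, 13], [2, 3, 12, 13], [2, 4, 11, 13], [3, 4, 11, 12], [5, 6, 9, 10],
     [5, 7, 8, 10], [6, 7, 8, 9]],
     [[1, 2, 3, 4], [0, 5, 6, 7], [0, 5, 8, 9], [0, 6, 8, 10], [0, 7, 9, 10], [1, 2, 11, 12], [1,
     3, 11, 13], [1, 4, 12, 13], [2, 3, 11, 14], [2, 4, 12, 14], [3, 4, 13, 14], [5, 6, 8, 15],
     [5, 7, 9, 15], [6, 7, 10, 15], [8, 9, 10, 15], [11, 12, 13, 14]],
     [[1, 2, 3, 4], [0, 2, 3, 5], [0, 1, 4, 5], [0, 1, 4, 5], [0, 2, 3, 5], [1, 2, 3, 4]],
     [[1, 2, 3, 4], [0, 5, 6, 7], [0, 5, 6, 7], [0, 5, 6, 7], [0, 5, 6, 7], [1, 2, 3, 4], [1, 2,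
     3, 4], [1, 2, 3, 4]],
     [[1, 2, 3, 4], [0, 5, 6, 7], [0, 5, 6, 7], [0, 5, 8, 9], [0, 5, 8, 9], [1, 2, 3, 4], [1, 2,
     8, 9], [1, 2, 8, 9], [3, 4, 6, 7], [3, 4, 6, 7]],
     [[1, 2, 3, 4], [0, 2, 3, 4], [0, 1, 5, 6], [0, 1, 5, 6], [0, 1, 5, 6], [2, 3, 4, 6], [2, 3,
     4, 5]],
     [[1, 2, 3, 4], [0, 2, 5, 6], [0, 1, 7, 8], [0, 4, 5, 7], [0, 3, 6, 8], [1, 3, 6, 7], [1, 4,
     5, 8], [2, 3, 5, 8], [2, 4, 6, 7]],
     [[1, 2, 3, 4], [0, 2, 5, 6], [0, 1, 7, 8], [0, 4, 5, 7], [0, 3, 6, 8], [1, 3, 6, 8], [1, 4,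
     5, 7], [2, 3, 6, 8], [2, 4, 5, 7]],
     [[1, 2, 3, 4], [0, 2, 5, 6], [0, 1, 7, 8], [0, 5, 6, 7], [0, 5, 7, 8], [1, 3, 4, 8], [1, 3,
     7, 8], [2, 3, 4, 6], [2, 4, 5, 6]],
     [[1, 2, 3, 4], [0, 5, 6, 7], [0, 5, 6, 7], [0, 5, 8, 9], [0, 6, 8, 9], [1, 2, 3, 10], [1, 2,
     4, 11], [1, 2, 10, 11], [3, 4, 10, 11], [3, 4, 10, 11], [5, 7, 8, 9], [6, 7, 8, 9]]]"

text \<open>Pair \<open>p\<close> is \<open>2 * p\<close>, \<open>2 * p + 1\<close>, as in
  \<open>closed_chain_labelling\<close>. The end pairs have only two listed neighbours each, and
  whether they are joined to each other stays open.\<close>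

definition ladder :: "nat list list" where
  "ladder =
     [[2, 3], [2, 3], [0, 1, 4, 5], [0, 1, 4, 5], [2, 3, 6, 7], [2, 3, 6, 7], [4, 5, 8, 9], [4, 5, 8, 9], [6, 7], [6, 7]]"

text \<open>The order matters, because notes made while excluding one pattern are cited for later
  ones. The last entry, one vertex about which nothing is known, is the real target.\<close>

definition patterns :: "nat list list list" where
  "patterns = [
     [[3, 2, 1], [3, 2, 0], [3, 1, 0], [2, 1, 0]],
     [[3, 2, 1], [3, 2, 0], [1, 0], [1, 0]],
     [[2, 1], [2, 0], [1, 0]],
     [[5, 4, 3, 2], [5, 4, 3, 2], [1, 0], [1, 0], [1, 0], [1, 0]],
     [[4, 3, 2], [4, 3, 2], [1, 0], [1, 0], [1, 0]],
     [[]]]"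

text \<open>
  The certificates were found by a computer search that always branches where the fewest
  non-trivial cases arise.
\<close>

definition certs :: "cert list" where
  "certs = [
     Note 31 (Nbr 0 [Nbr 1 [Note 29 (Nbr 2 [Nbr 3 [Sub 0 [0, 1, 2, 3, 4], Note 24 (Com 0 5 [Nbr 5
     [Com 3 6 []]])], Note 28 (Com 0 5 [Note 26 (Nbr 4 [Sub 24 [0, 1, 3, 2, 4, 5], Com 0 6 [Note
     25 (Com 2 6 [Nbr 5 [Com 2 7 []]])]]), Note 27 (Nbr 4 [Sub 26 [0, 1, 2, 3, 4, 5], Com 0 6
     []])])]), Com 0 5 [Nbr 2 [Sub 26 [0, 2, 1, 3, 4, 5], Sub 26 [1, 2, 0, 3, 5, 4], Com 0 6 [Com
     1 6 [Nbr 4 [Sub 25 [0, 3, 1, 2, 4, 5, 6], Com 0 7 [Note 30 (Com 1 7 [Com 2 7 [Sub 5 [0, 1, 2,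
     3, 4, 5, 6, 7]]])]], Sub 26 [2, 3, 0, 1, 6, 4]], Sub 28 [2, 3, 0, 1, 6, 4]]], Sub 28 [1, 3,
     0, 2, 5, 4], Sub 28 [1, 2, 0, 3, 5, 4]]]]),
     Note 53 (Nbr 0 [Note 52 (Nbr 1 [Note 36 (Nbr 2 [Sub 29 [0, 1, 2, 3, 4], Sub 29 [0, 1, 2, 4,
     3], Nbr 2 [Com 0 5 [Note 35 (Com 0 6 [Nbr 3 [Note 32 (Nbr 3 [Nbr 5 [Sub 18 [0, 1, 2, 3, 4, 5,
     6], Com 2 7 [Nbr 7 [Com 5 8 []]]], Com 0 7 []]), Sub 32 [0, 1, 2, 3, 4, 6, 5], Com 0 7 []],
     Nbr 3 [Sub 25 [0, 1, 3, 4, 2, 6, 5], Sub 32 [0, 1, 2, 4, 3, 5, 6], Com 0 7 [Nbr 5 [Note 33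
     (Com 3 5 [Com 2 7 [Sub 4 [0, 1, 2, 3, 4, 6, 5, 7]]]), Com 3 5 [], Com 2 8 [Com 3 8 [Nbr 5
     [Com 2 9 [Com 3 9 [Note 34 (Nbr 8 [Sub 10 [0, 1, 2, 3, 4, 6, 5, 7, 8, 9], Com 5 10 [Nbr 10
     [Com 8 11 []]]])]]]]]]]]]), Sub 35 [0, 1, 2, 4, 3, 5, 6]]]]), Note 51 (Com 0 5 [Nbr 4 [Note
     42 (Nbr 4 [Nbr 2 [Sub 24 [0, 2, 3, 1, 4, 5], Nbr 3 [Sub 15 [0, 1, 2, 3, 4, 5], Com 0 6 []],
     Com 0 6 [Nbr 5 [Nbr 5 [Com 1 7 []], Com 1 7 []]]], Com 0 6 [Com 1 6 [Note 38 (Nbr 6 [Note 37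
     (Nbr 3 [Sub 1 [0, 1, 2, 3, 4, 5, 6], Com 0 7 []]), Com 6 2 [Com 0 7 [Nbr 5 [Sub 3 [0, 1, 2,
     3, 4, 5, 7, 6], Com 1 8 []]], Com 4 7 [], Sub 25 [0, 2, 1, 3, 4, 5, 6]]]), Note 39 (Nbr 3
     [Sub 37 [1, 3, 0, 5, 2, 6, 4], Com 0 7 []])], Note 41 (Com 1 6 [Note 40 (Com 4 3 [Sub 37 [0,
     1, 2, 3, 4, 5, 6], Sub 38 [1, 0, 3, 2, 5, 4, 6]]), Sub 39 [0, 1, 2, 3, 4, 5, 6]])]]), Sub 42
     [0, 1, 3, 2, 4, 5], Nbr 4 [Com 0 6 [Note 49 (Com 0 7 [Com 1 6 [Note 45 (Com 1 7 [Com 4 2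
     [Note 43 (Nbr 2 [Sub 2 [0, 1, 2, 3, 4, 5, 6, 7], Com 0 8 []]), Sub 43 [0, 1, 2, 3, 4, 5, 7,
     6]], Note 44 (Nbr 2 [Sub 38 [1, 0, 2, 3, 5, 4, 6], Nbr 5 [Sub 43 [0, 1, 3, 2, 4, 5, 7, 6],
     Com 1 8 []], Com 0 8 []])]), Note 46 (Com 3 5 [Sub 44 [0, 1, 2, 3, 4, 5, 7, 6], Sub 45 [0, 1,
     2, 3, 4, 5, 6, 7]])], Note 48 (Com 1 6 [Note 47 (Com 1 7 [Nbr 2 [Sub 30 [0, 1, 2, 3, 4, 5, 7,
     6], Sub 43 [0, 1, 3, 2, 4, 5, 7, 6], Com 0 8 [Nbr 6 [Sub 30 [4, 5, 6, 7, 0, 1, 3, 2], Com 2 6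
     [], Com 3 9 [Nbr 8 [Com 2 9 [], Com 3 10 []]]]]], Sub 44 [0, 1, 2, 3, 4, 5, 6, 7]]), Sub 46
     [0, 1, 3, 2, 4, 5, 6, 7]])]), Sub 49 [0, 1, 3, 2, 4, 5, 6, 7]]]], Note 50 (Com 1 4 [Sub 42
     [1, 0, 3, 2, 5, 4], Nbr 2 [Sub 42 [1, 3, 0, 5, 2, 4], Sub 42 [0, 3, 1, 4, 2, 5], Com 0 6 [Com
     1 6 [Nbr 2 [Com 0 7 [Com 1 7 [Nbr 6 [Sub 33 [6, 7, 2, 4, 5, 1, 0, 3], Com 2 8 [Nbr 8 [Com 6 9
     []]]]]]]]]], Nbr 2 [Sub 27 [0, 2, 1, 3, 4, 5], Sub 42 [0, 2, 1, 4, 3, 5], Com 0 6 [Com 1 6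
     [Nbr 5 [Sub 38 [1, 0, 3, 2, 5, 4, 6], Com 1 7 [Com 0 7 [Com 2 7 [Sub 6 [0, 1, 2, 3, 4, 5, 6,
     7]]]]], Sub 40 [1, 3, 0, 5, 2, 6, 4]], Sub 41 [0, 2, 1, 4, 3, 6, 5]]]]), Sub 50 [0, 1, 3, 2,
     4, 5]])])]),
     Note 66 (Nbr 0 [Nbr 0 [Note 65 (Nbr 1 [Sub 52 [0, 1, 2, 3, 4], Sub 52 [0, 1, 2, 4, 3], Nbr 1
     [Note 64 (Nbr 2 [Sub 52 [0, 2, 1, 3, 4], Sub 52 [0, 2, 1, 4, 3], Sub 52 [1, 2, 0, 5, 6], Sub
     52 [1, 2, 0, 6, 5], Nbr 2 [Com 0 5 [Note 63 (Com 0 6 [Com 0 7 [Com 0 8 [Note 58 (Com 1 3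
     [Note 57 (Com 1 7 [Note 55 (Com 1 8 [Com 4 8 [Note 54 (Nbr 3 [Sub 20 [2, 8, 7, 0, 1, 3, 5, 4,
     6], Com 0 9 []])]]), Com 2 6 [Note 56 (Nbr 3 [Sub 55 [0, 1, 2, 4, 3, 5, 6, 8, 7], Com 3 5
     [Sub 21 [0, 1, 2, 4, 3, 6, 5, 7, 8]], Com 0 9 []]), Sub 45 [4, 7, 5, 6, 0, 2, 1, 3]]]), Sub
     57 [0, 1, 2, 3, 4, 6, 5, 7, 8]])], Com 0 8 [Sub 58 [0, 1, 2, 3, 4, 5, 6, 8, 7], Com 1 3 [Sub
     58 [0, 2, 1, 4, 3, 8, 7, 6, 5], Sub 58 [0, 2, 1, 4, 3, 8, 7, 5, 6]]]], Com 0 7 [Note 62 (Com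
     0 8 [Sub 58 [0, 2, 1, 3, 4, 8, 7, 5, 6], Note 61 (Com 1 7 [Com 1 8 [Sub 58 [1, 2, 0, 5, 6, 8,
     7, 3, 4], Nbr 3 [Nbr 5 [Sub 54 [3, 4, 0, 8, 6, 7, 5, 1, 2], Sub 54 [1, 2, 0, 6, 5, 8, 7, 4,
     3], Com 1 9 [Note 59 (Com 3 9 [Com 2 9 [Sub 9 [0, 1, 2, 3, 4, 6, 5, 8, 7, 9]]])]], Sub 55 [0,
     1, 2, 4, 3, 6, 5, 8, 7], Sub 55 [0, 2, 1, 4, 3, 8, 7, 6, 5], Com 0 9 [Com 3 5 [Com 3 7 [Sub
     48 [4, 9, 5, 7, 0, 3, 2, 1], Sub 59 [2, 0, 1, 8, 7, 4, 3, 6, 5, 9]], Sub 59 [1, 0, 2, 5, 6,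
     3, 4, 7, 8, 9]]]]], Com 1 8 [Nbr 3 [Note 60 (Com 3 5 [Sub 56 [1, 2, 0, 6, 5, 7, 8, 4, 3], Com
     3 7 [Sub 19 [0, 1, 2, 3, 4, 6, 5, 8, 7]]]), Sub 56 [0, 1, 2, 4, 3, 6, 5, 8, 7], Sub 56 [0, 2,
     1, 4, 3, 8, 7, 6, 5], Com 0 9 [Nbr 5 [Sub 60 [1, 0, 2, 5, 6, 3, 4, 8, 7], Sub 56 [1, 2, 0, 6,
     5, 7, 8, 4, 3], Sub 47 [4, 5, 9, 7, 0, 1, 2, 3], Com 1 10 [Com 3 10 [Nbr 9 [Sub 47 [4, 7, 9,
     5, 0, 2, 1, 3], Sub 47 [3, 8, 9, 6, 0, 2, 1, 4], Com 3 11 [Com 2 11 [Com 5 11 [Sub 7 [0, 1,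
     2, 3, 4, 6, 5, 8, 7, 9, 10, 11]]]]], Sub 47 [6, 8, 10, 3, 1, 2, 0, 5]]]]]], Sub 58 [1, 2, 0,
     6, 5, 8, 7, 4, 3]]])]), Sub 62 [0, 1, 2, 4, 3, 6, 5, 7, 8]]]), Sub 63 [0, 1, 2, 4, 3, 5, 6,
     7, 8]]]])]])]]),
     Note 77 (Nbr 2 [Sub 53 [2, 3, 0, 1], Sub 53 [2, 4, 0, 1], Sub 53 [2, 5, 0, 1], Nbr 2 [Com 0 6
     [Note 76 (Nbr 5 [Sub 52 [5, 3, 0, 1, 6], Sub 52 [5, 4, 0, 1, 6], Nbr 3 [Sub 53 [3, 4, 0, 1],
     Note 71 (Nbr 3 [Note 68 (Nbr 4 [Note 67 (Nbr 4 [Sub 16 [0, 2, 3, 4, 5, 1, 6, 7], Com 0 8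
     []]), Sub 67 [0, 1, 2, 3, 4, 5, 7, 6], Com 0 8 []]), Com 0 8 [Note 70 (Nbr 4 [Sub 68 [2, 5,
     0, 1, 7, 6, 3, 4], Note 69 (Nbr 6 [Sub 51 [6, 7, 2, 5, 3, 4], Sub 64 [3, 6, 8, 0, 1, 2, 5],
     Com 2 9 [Com 3 9 [Nbr 8 [Com 3 10 []]]]]), Com 0 9 []])]]), Sub 71 [0, 1, 2, 3, 4, 5, 7, 6],
     Com 0 8 [Nbr 3 [Com 0 9 [Sub 23 [6, 7, 2, 5, 0, 1, 3, 4, 8, 9]]]]], Com 0 7 [Note 75 (Com 0 8
     [Nbr 6 [Note 72 (Nbr 3 [Sub 69 [0, 1, 2, 4, 5, 3, 7, 6, 8], Sub 69 [0, 1, 3, 2, 4, 5, 6, 8,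
     7], Com 0 9 []]), Sub 65 [2, 6, 7, 0, 1], Sub 65 [5, 6, 8, 0, 1], Note 73 (Nbr 3 [Sub 72 [0,
     1, 2, 3, 5, 4, 7, 6, 8], Sub 72 [0, 1, 4, 3, 2, 5, 8, 7, 6], Com 0 9 [], Com 0 10 []])], Note
     74 (Nbr 3 [Sub 51 [3, 4, 0, 1, 8, 7], Sub 70 [0, 1, 3, 2, 4, 5, 6, 8, 7], Sub 72 [0, 1, 2, 4,
     5, 3, 7, 6, 8], Com 0 9 [Nbr 6 [Sub 65 [2, 6, 7, 0, 1], Sub 65 [5, 6, 8, 0, 1], Com 3 6 [],
     Com 2 10 [Com 4 10 [Com 3 10 [Nbr 6 [Com 2 11 [Com 4 11 [Com 3 11 [Sub 22 [2, 0, 1, 6, 7, 5,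
     4, 3, 11, 10, 8, 9]]]]]]]]]]])]), Sub 75 [0, 1, 2, 4, 3, 5, 6, 7, 8]]]), Sub 76 [0, 1, 2, 3,
     5, 4, 6, 7], Sub 76 [0, 1, 2, 4, 5, 3, 6, 7]]]]),
     Note 94 (Nbr 0 [Sub 36 [0, 1, 2, 3, 4], Note 93 (Nbr 1 [Sub 77 [0, 1, 2, 3, 4, 5], Nbr 2 [Sub
     53 [2, 3, 0, 1], Sub 53 [2, 4, 0, 1], Sub 65 [0, 2, 5, 3, 4], Sub 65 [1, 2, 6, 3, 4], Nbr 2
     [Com 2 5 [Note 92 (Com 2 6 [Note 90 (Nbr 5 [Sub 65 [0, 3, 5, 2, 4], Sub 65 [0, 4, 5, 2, 3],
     Sub 66 [5, 8, 6], Nbr 5 [Note 85 (Com 0 9 [Note 84 (Com 1 9 [Note 83 (Nbr 6 [Sub 64 [1, 6, 3,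
     2, 4, 8, 9], Sub 51 [4, 6, 1, 9, 0, 8], Note 81 (Nbr 9 [Note 79 (Nbr 3 [Sub 34 [3, 4, 0, 1,
     9, 5, 2, 6, 8, 7], Note 78 (Nbr 4 [Sub 11 [0, 2, 3, 4, 5, 1, 7, 8, 9, 6], Com 0 10 []]), Sub
     78 [0, 1, 2, 3, 4, 5, 6, 8, 7, 9], Com 0 10 [Sub 73 [3, 4, 0, 10, 1, 9, 5, 2, 6, 8]]]), Sub
     51 [7, 9, 5, 6, 2, 4], Sub 51 [8, 9, 5, 6, 2, 4], Note 80 (Nbr 4 [Sub 52 [4, 3, 0, 1, 9], Com
     4 10 [], Com 4 10 [], Sub 64 [4, 9, 10, 0, 1, 5, 6], Com 0 11 [Com 5 3 [Com 7 11 [], Com 8 11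
     []]]])]), Note 82 (Nbr 9 [Sub 80 [2, 5, 0, 7, 8, 1, 9, 4, 3, 6, 10], Sub 64 [5, 9, 7, 0, 8,
     4, 6], Sub 51 [8, 9, 5, 6, 2, 4], Sub 64 [6, 9, 10, 8, 1, 4, 5], Nbr 10 [Com 0 10 [Com 1 7
     [Com 4 11 [Com 3 11 [Com 2 11 [Sub 12 [0, 2, 3, 5, 4, 7, 1, 8, 10, 9, 11, 6]]]]]], Com 0 10
     [], Com 1 10 [], Sub 64 [6, 8, 10, 1, 9, 2, 5], Com 1 10 [], Com 1 10 []]])]), Com 5 6 [Sub
     81 [2, 5, 0, 7, 8, 1, 9, 4, 3, 6], Nbr 6 [Sub 58 [1, 6, 3, 4, 2, 8, 7, 0, 9], Sub 58 [1, 6,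
     4, 3, 2, 8, 7, 0, 9], Sub 79 [0, 1, 2, 3, 4, 5, 6, 7, 8, 9], Com 6 3 [Com 0 10 [Sub 74 [3, 4,
     0, 10, 9, 1, 2, 5, 6]], Sub 82 [0, 1, 3, 4, 2, 5, 6, 9, 7, 8, 10], Sub 82 [0, 1, 3, 4, 2, 5,
     6, 9, 8, 7, 10]]]]]), Sub 84 [0, 1, 2, 4, 3, 5, 6, 7, 8, 9]])], Nbr 5 [Note 89 (Com 0 7 [Note
     88 (Com 0 9 [Note 87 (Com 0 10 [Com 1 10 [Note 86 (Com 1 9 [Nbr 3 [Nbr 7 [Sub 57 [2, 7, 8, 1,
     0, 4, 3, 5, 6], Sub 57 [4, 7, 9, 1, 0, 3, 2, 5, 6], Sub 57 [3, 7, 10, 1, 0, 4, 2, 5, 6], Com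
     2 11 [Com 3 11 [Com 4 11 [Sub 8 [0, 2, 3, 4, 5, 1, 7, 8, 10, 9, 6, 11]]]]], Sub 80 [5, 6, 8,
     10, 9, 0, 1, 3, 2, 4, 7], Sub 80 [5, 6, 9, 10, 8, 0, 1, 4, 3, 2, 7], Com 0 11 []], Sub 83 [0,
     1, 3, 4, 2, 5, 6, 9, 10, 8]])]]), Com 0 10 [Sub 87 [0, 1, 2, 3, 4, 5, 6, 7, 8, 10, 9], Sub 85
     [3, 5, 0, 10, 9, 1, 8, 4, 2, 6]]]), Sub 88 [0, 1, 2, 4, 3, 5, 6, 7, 8, 9, 10]])]]), Nbr 5
     [Sub 65 [0, 3, 5, 2, 4], Sub 65 [0, 4, 5, 2, 3], Com 1 5 [], Sub 90 [0, 1, 2, 3, 4, 5, 6, 8,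
     7], Nbr 5 [Com 0 7 [Note 91 (Com 5 4 [Sub 90 [2, 4, 0, 1, 7, 8, 10, 3, 5], Sub 90 [2, 4, 0,
     1, 7, 8, 9, 3, 5], Sub 74 [2, 4, 0, 7, 8, 1, 3, 5, 6]]), Sub 91 [0, 1, 2, 4, 3, 5, 6, 7, 8,
     9, 10]]]]]), Sub 92 [0, 1, 2, 3, 4, 5, 6, 8, 7]]]]])]),
     Note 99 (Nbr 0 [Nbr 0 [Nbr 0 [Nbr 0 [Nbr 1 [Sub 65 [0, 1, 2, 3, 4], Sub 65 [0, 1, 3, 2, 4],
     Sub 65 [0, 1, 4, 2, 3], Nbr 1 [Nbr 1 [Com 0 5 [Note 98 (Nbr 4 [Sub 65 [0, 2, 4, 1, 3], Sub 65
     [0, 3, 4, 1, 2], Sub 93 [1, 4, 0, 5, 6, 7], Sub 93 [1, 4, 0, 5, 7, 6], Nbr 4 [Nbr 5 [Sub 93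
     [0, 5, 1, 2, 4, 3], Sub 93 [0, 5, 1, 3, 4, 2], Sub 65 [1, 5, 6, 0, 7], Sub 65 [1, 5, 7, 0,
     6], Sub 65 [4, 8, 5, 0, 9], Sub 65 [4, 5, 9, 0, 8], Nbr 5 [Com 0 6 [Note 97 (Com 0 7 [Sub 93
     [1, 3, 0, 6, 7, 5], Com 0 8 [Note 96 (Com 0 9 [Sub 89 [4, 3, 0, 8, 9, 5, 6, 2, 1, 11, 10],
     Nbr 2 [Sub 61 [0, 2, 3, 1, 4, 9, 7, 8, 6], Sub 88 [1, 2, 0, 7, 6, 5, 9, 3, 4, 11, 10], Sub 88
     [4, 2, 0, 9, 8, 5, 7, 3, 1, 11, 10], Com 2 5 [], Com 2 5 [], Com 0 12 [Com 1 10 [Note 95 (Com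
     1 11 [Sub 89 [5, 7, 1, 10, 11, 4, 2, 6, 0, 9, 8], Nbr 6 [Sub 61 [1, 6, 7, 0, 5, 11, 3, 10,
     2], Sub 64 [3, 6, 8, 0, 12, 11, 1], Com 2 6 [], Sub 88 [5, 6, 1, 11, 10, 4, 3, 7, 0, 9, 8],
     Sub 64 [3, 6, 12, 0, 8, 11, 1], Com 1 13 [Com 2 10 [Com 3 10 [Com 5 9 [Com 2 11 [Com 2 13
     [Com 3 13 [Sub 13 [0, 1, 2, 3, 4, 7, 6, 5, 12, 9, 8, 13, 10, 11]]]]]], Com 2 13 [Com 3 11
     [Sub 89 [6, 12, 3, 11, 13, 1, 2, 8, 0, 7, 5], Nbr 8 [Sub 61 [4, 8, 9, 0, 5, 11, 3, 10, 2],
     Sub 86 [4, 10, 5, 9, 8, 0, 7, 11, 1, 3, 2], Sub 61 [3, 8, 12, 0, 6, 11, 4, 13, 2], Sub 86 [3,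
     13, 6, 12, 8, 0, 7, 11, 1, 4, 2], Com 3 14 [Com 2 14 [Nbr 10 [Sub 61 [5, 10, 11, 1, 4, 9, 7,
     8, 6], Sub 61 [7, 10, 13, 1, 2, 9, 5, 12, 6], Sub 61 [9, 10, 14, 2, 4, 5, 7, 8, 12], Com 5 15
     [Com 6 15 [Com 8 15 [Sub 14 [0, 1, 2, 3, 4, 7, 6, 5, 12, 9, 8, 13, 10, 11, 14, 15]]]]]]]]],
     Sub 89 [7, 9, 2, 10, 13, 1, 4, 12, 0, 6, 5]]]]]]), Sub 95 [0, 1, 3, 2, 4, 5, 7, 6, 9, 8, 10,
     11, 12]]]]]), Sub 96 [0, 1, 3, 2, 4, 5, 7, 6, 8, 9, 10, 11]]]), Sub 97 [0, 1, 3, 2, 4, 5, 6,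
     7, 8, 9, 10, 11]]]]]]), Sub 98 [0, 1, 2, 4, 3, 5, 6, 7], Sub 98 [0, 1, 3, 4, 2, 5, 6,
     7]]]]]]]]])]"

definition bare :: "nat list list \<Rightarrow> pgraph" where
  "bare A = (A, map (\<lambda>_. []) A)"

text \<open>Numbers 0 to 22 are the complete graphs of the list \<open>finals\<close> and 23 is the
  ladder; the notes in \<open>certs\<close> continue from 24.\<close>

definition known :: "(nat \<times> pgraph) list" where
  "known = zip [0..<24] (map bare (finals @ [ladder]))"

text \<open>The search is replayed by rewriting in the kernel, without trust in compiled
  code.\<close>

lemma check_certs: "check_list known (map bare patterns) certs \<noteq> None"
  by code_simp

lemma wf_lists:
  "\<forall>A \<in> set (patterns @ finals @ [ladder]). \<forall>ns \<in> set A. distinct ns \<and> (\<forall>j \<in> set ns. j < length A)"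
  by code_simp

lemma length_finals: "length finals = 23"
  by (simp add: finals_def)

lemma finals_full: "\<forall>A \<in> set finals. A \<noteq> [] \<and> (\<forall>ns \<in> set A. length ns = 4)"
  by code_simp

lemma wf_bare:
  "\<forall>ns \<in> set A. distinct ns \<and> (\<forall>j \<in> set ns. j < length A) \<Longrightarrow> wf_pgraph (bare A)"
  by (auto simp: bare_def)

lemma wf_bare_lists: "A \<in> set (patterns @ finals @ [ladder]) \<Longrightarrow> wf_pgraph (bare A)"
  by (rule wf_bare) (rule bspec[OF wf_lists])

context quadrangular
begin

lemma occurs_final_or_ladder: "(\<exists>A \<in> set finals. occurs (bare A)) \<or> occurs (bare ladder)"
proof (rule ccontr)
  assume no: "\<not> ?thesis"
  have "\<forall>(x, T) \<in> set known. avoided T"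
  proof safe
    fix x A Q assume "(x, A, Q) \<in> set known"
    then have "(A, Q) \<in> set (map bare (finals @ [ladder]))"
      unfolding known_def by (rule set_zip_rightD)
    then obtain B where B: "B \<in> set (finals @ [ladder])" "(A, Q) = bare B" by auto
    then have "wf_pgraph (bare B)" by (intro wf_bare_lists) auto
    then show "avoided (A, Q)" using no B unfolding avoided_def by auto
  qed
  moreover have "\<forall>S \<in> set (map bare patterns). wf_pgraph S"
  proof
    fix S assume "S \<in> set (map bare patterns)"
    then obtain B where B: "B \<in> set patterns" "S = bare B" by auto
    then show "wf_pgraph S" using wf_bare_lists by simp
  qed
  ultimately have "\<forall>S \<in> set (map bare patterns). avoided S"
    using check_certs check_sound(2) by blast
  then have "avoided (bare [[]])" by (simp add: patterns_def)
  moreover obtain v where "v \<in> V" using V_nonempty by blast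
  then have "realizes (\<lambda>_. v) (bare [[]])" by (auto simp: bare_def inj_on_def)
  ultimately show False unfolding avoided_def occurs_def by blast
qed

lemma chain_ladder:
  assumes "realizes f (bare ladder)"
  shows "chain (\<lambda>p. {f (2 * p), f (2 * p + 1)}) 5"
proof -
  have len: "length ladder = 10" by (simp add: ladder_def)
  have r: "inj_on f {..<10}" "f ` {..<10} \<subseteq> V" "\<And>i j. i < 10 \<Longrightarrow> j \<in> set (ladder ! i) \<Longrightarrow> E (f i) (f j)"
    using assms len by (auto simp: bare_def)
  have inj: "f i = f j \<longleftrightarrow> i = j" if "i < 10" "j < 10" for i j
    using inj_on_eq_iff[OF r(1)] that by auto
  have "E x y" if "Suc p < 5" "x \<in> {f (2 * p), f (2 * p + 1)}"
    "y \<in> {f (2 * Suc p), f (2 * Suc p + 1)}" for p x y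
  proof -
    have "p = 0 \<or> p = 1 \<or> p = 2 \<or> p = 3" using that(1) by arith
    then have "\<forall>i \<in> {2 * p, 2 * p + 1}. {2 * Suc p, 2 * Suc p + 1} \<subseteq> set (ladder ! i)"
      by (elim disjE) (simp_all add: ladder_def)
    then show ?thesis using that r(3)[of "2 * p"] r(3)[of "2 * p + 1"] by auto
  qed
  moreover have "card {f (2 * p), f (2 * p + 1)} = 2 \<and> {f (2 * p), f (2 * p + 1)} \<subseteq> V" if "p < 5" for p
    using that inj[of "2 * p" "2 * p + 1"] r(2) by auto
  moreover have "{f (2 * p), f (2 * p + 1)} \<inter> {f (2 * q), f (2 * q + 1)} = {}"
    if "p < 5" "q < 5" "p \<noteq> q" for p q
    using that inj[of "2 * p" "2 * q"] inj[of "2 * p" "2 * q + 1"] inj[of "2 * p + 1" "2 * q"]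
      inj[of "2 * p + 1" "2 * q + 1"] by simp
  ultimately show ?thesis unfolding chain_def by blast
qed

end

section \<open>Graphs excluded by signs and diagonal entries\<close>

text \<open>The relation between \<open>w\<close> and \<open>d\<close> in terms of indices. Summing
  over a filtered list lets the simplifier compute the equations of a concrete graph.\<close>

definition balanced :: "nat list list \<Rightarrow> (nat \<Rightarrow> nat \<Rightarrow> real) \<Rightarrow> (nat \<Rightarrow> real) \<Rightarrow> bool" where
  "balanced A W D \<longleftrightarrow> (\<forall>i j. W i j = W j i) \<and>
     (\<forall>i < length A. \<forall>j \<in> set (A ! i). W i j \<noteq> 0) \<and>
     (\<forall>i < length A. \<forall>j < length A. i \<noteq> j \<longrightarrow>
        (if j \<in> set (A ! i) then (D i + D j) * W i j else 0) +
        (\<Sum>k \<leftarrow> filter (\<lambda>k. k \<in> set (A ! j)) (A ! i). W i k * W j k) = 0)"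

lemma balanced_sym: "balanced A W D \<Longrightarrow> W i j = W j i"
  unfolding balanced_def by blast

lemma balanced_nonzero: "balanced A W D \<Longrightarrow> i < length A \<Longrightarrow> j \<in> set (A ! i) \<Longrightarrow> W i j \<noteq> 0"
  unfolding balanced_def by blast

lemma balanced_eq:
  "balanced A W D \<Longrightarrow> i < length A \<Longrightarrow> j < length A \<Longrightarrow> i \<noteq> j \<Longrightarrow>
     (if j \<in> set (A ! i) then (D i + D j) * W i j else 0) +
     (\<Sum>k \<leftarrow> filter (\<lambda>k. k \<in> set (A ! j)) (A ! i). W i k * W j k) = 0"
  unfolding balanced_def by blast

text \<open>Two non-zero products with sum zero are negatives of each other, so multiplying them
  gives minus a square.\<close>

lemma balanced_quadrangle:
  assumes b: "balanced A W D" and "i < length A" "j < length A" "i \<noteq> j" "j \<notin> set (A ! i)"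
    and kl: "filter (\<lambda>k. k \<in> set (A ! j)) (A ! i) = [k, l]"
  shows "W i k * W j k * (W i l * W j l) < 0"
proof -
  have "W i k * W j k + W i l * W j l = 0" using balanced_eq[OF b] assms by fastforce
  then have "W i k * W j k * (W i l * W j l) = - ((W i k * W j k)\<^sup>2)"
    by (simp add: power2_eq_square add_eq_0_iff)
  moreover have "k \<in> set (A ! i)" "k \<in> set (A ! j)"
    using arg_cong[OF kl, of set] by auto
  then have "W i k * W j k \<noteq> 0" using balanced_nonzero[OF b] assms by simp
  ultimately show ?thesis by simp
qed

lemma balanced_no_common:
  assumes "balanced A W D" "i < length A" "j < length A" "i \<noteq> j" "j \<in> set (A ! i)"
    and "filter (\<lambda>k. k \<in> set (A ! j)) (A ! i) = []"
  shows "D i + D j = 0"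
  using balanced_eq[OF assms(1-4)] balanced_nonzero[OF assms(1,2,5)] assms(5,6) by simp

lemma prod_list_neg:
  fixes xs :: "real list"
  shows "\<forall>x \<in> set xs. x < 0 \<Longrightarrow> odd (length xs) \<Longrightarrow> prod_list xs < 0"
    and "\<forall>x \<in> set xs. x < 0 \<Longrightarrow> even (length xs) \<Longrightarrow> prod_list xs > 0"
  by (induction xs) (auto simp: mult_neg_pos mult_neg_neg)

text \<open>A parity argument on signs: the nine quadrangles cover each of the 18 edges exactly
  twice, so the product of their weights is a square, while it has nine negative factors.\<close>

lemma not_balanced_19: "\<not> balanced (finals ! 19) W D"
proof
  assume b: "balanced (finals ! 19) W D"
  note q = balanced_quadrangle[OF b] and s = balanced_sym[OF b]
  let ?xs = "[
    W 0 1 * W 5 1 * (W 0 3 * W 5 3),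
    W 0 1 * W 6 1 * (W 0 4 * W 6 4),
    W 0 2 * W 7 2 * (W 0 3 * W 7 3),
    W 0 2 * W 8 2 * (W 0 4 * W 8 4),
    W 1 2 * W 7 2 * (W 1 5 * W 7 5),
    W 1 2 * W 8 2 * (W 1 6 * W 8 6),
    W 3 4 * W 6 4 * (W 3 5 * W 6 5),
    W 3 4 * W 8 4 * (W 3 7 * W 8 7),
    W 5 6 * W 8 6 * (W 5 7 * W 8 7)]"
  have "\<forall>x \<in> set ?xs. x < 0"
    using q[of 0 5 1 3] q[of 0 6 1 4] q[of 0 7 2 3] q[of 0 8 2 4] q[of 1 7 2 5] q[of 1 8 2
      6] q[of 3 6 4 5] q[of 3 8 4 7] q[of 5 8 6 7]
    by (simp add: finals_def)
  then have "prod_list ?xs < 0" by (rule prod_list_neg) simp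
  moreover have "prod_list ?xs =
    (W 0 1 * W 0 2 * W 0 3 * W 0 4 * W 1 2 * W 1 5 * W 1 6 * W 2 7 * W 2 8 * W 3 4 * W 3 5 *
     W 3 7 * W 4 6 * W 4 8 * W 5 6 * W 5 7 * W 6 8 * W 7 8)\<^sup>2"
    unfolding s[of 5 1] s[of 5 3] s[of 6 1] s[of 6 4] s[of 6 5] s[of 7 2] s[of 7 3] s[of 7
      5] s[of 8 2] s[of 8 4] s[of 8 6] s[of 8 7]
    by (simp add: power2_eq_square)
  ultimately show False by (metis not_less zero_le_power2)
qed

text \<open>Again nine quadrangles that cover each of the 18 edges exactly twice.\<close>

lemma not_balanced_21: "\<not> balanced (finals ! 21) W D"
proof
  assume b: "balanced (finals ! 21) W D"
  note q = balanced_quadrangle[OF b] and s = balanced_sym[OF b]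
  let ?xs = "[
    W 0 1 * W 6 1 * (W 0 3 * W 6 3),
    W 0 2 * W 8 2 * (W 0 4 * W 8 4),
    W 1 0 * W 4 0 * (W 1 5 * W 4 5),
    W 1 2 * W 7 2 * (W 1 6 * W 7 6),
    W 2 0 * W 3 0 * (W 2 7 * W 3 7),
    W 2 1 * W 5 1 * (W 2 8 * W 5 8),
    W 3 5 * W 8 5 * (W 3 6 * W 8 6),
    W 4 7 * W 6 7 * (W 4 8 * W 6 8),
    W 5 3 * W 7 3 * (W 5 4 * W 7 4)]"
  have "\<forall>x \<in> set ?xs. x < 0"
    using q[of 0 6 1 3] q[of 0 8 2 4] q[of 1 4 0 5] q[of 1 7 2 6] q[of 2 3 0 7] q[of 2 5 1
      8] q[of 3 8 5 6] q[of 4 6 7 8] q[of 5 7 3 4]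
    by (simp add: finals_def)
  then have "prod_list ?xs < 0" by (rule prod_list_neg) simp
  moreover have "prod_list ?xs =
    (W 0 1 * W 0 2 * W 0 3 * W 0 4 * W 1 2 * W 1 5 * W 1 6 * W 2 7 * W 2 8 * W 3 5 * W 3 6 *
     W 3 7 * W 4 5 * W 4 7 * W 4 8 * W 5 8 * W 6 7 * W 6 8)\<^sup>2"
    unfolding s[of 1 0] s[of 2 0] s[of 2 1] s[of 3 0] s[of 4 0] s[of 5 1] s[of 5 3] s[of 5
      4] s[of 6 1] s[of 6 3] s[of 7 2] s[of 7 3] s[of 7 4] s[of 7 6] s[of 8 2] s[of 8 4]
      s[of 8 5] s[of 8 6]
    by (simp add: power2_eq_square)
  ultimately show False by (metis not_less zero_le_power2)
qed

text \<open>Vertices 1 and 2 have the same neighbours. Two quadrangles through 1, their copies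
  through 2 and the quadrangle 0, 1, 7, 2 cover ten edges twice, and five is odd.\<close>

lemma not_balanced_22: "\<not> balanced (finals ! 22) W D"
proof
  assume b: "balanced (finals ! 22) W D"
  note q = balanced_quadrangle[OF b] and s = balanced_sym[OF b]
  let ?xs = "[
    W 0 1 * W 7 1 * (W 0 2 * W 7 2),
    W 1 0 * W 3 0 * (W 1 5 * W 3 5),
    W 1 5 * W 10 5 * (W 1 7 * W 10 7),
    W 2 0 * W 3 0 * (W 2 5 * W 3 5),
    W 2 5 * W 10 5 * (W 2 7 * W 10 7)]"
  have "\<forall>x \<in> set ?xs. x < 0"
    using q[of 0 7 1 2] q[of 1 3 0 5] q[of 1 10 5 7] q[of 2 3 0 5] q[of 2 10 5 7]
    by (simp add: finals_def)
  then have "prod_list ?xs < 0" by (rule prod_list_neg) simp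
  moreover have "prod_list ?xs =
    (W 0 1 * W 0 2 * W 0 3 * W 1 5 * W 1 7 * W 2 5 * W 2 7 * W 3 5 * W 5 10 * W 7 10)\<^sup>2"
    unfolding s[of 1 0] s[of 2 0] s[of 3 0] s[of 7 1] s[of 7 2] s[of 10 5] s[of 10 7]
    by (simp add: power2_eq_square)
  ultimately show False by (metis not_less zero_le_power2)
qed

text \<open>The edges of the path 3, 5, 8, 4 lie in no triangle, so \<open>D\<close> changes sign
  three times along it and \<open>D 3 + D 4 = 0\<close>. But the edge 34 has the single common
  neighbour 0, whose non-zero product then has nothing to cancel it.\<close>

lemma not_balanced_20: "\<not> balanced (finals ! 20) W D"
proof
  assume b: "balanced (finals ! 20) W D"
  have "D 3 + D 5 = 0" "D 5 + D 8 = 0" "D 8 + D 4 = 0"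
    by (rule balanced_no_common[OF b]; simp add: finals_def)+
  then have "D 3 + D 4 = 0" by simp
  moreover have "(D 3 + D 4) * W 3 4 + W 3 0 * W 4 0 = 0"
    using balanced_eq[OF b, of 3 4] by (simp add: finals_def)
  moreover have "W 3 0 \<noteq> 0" "W 4 0 \<noteq> 0"
    by (rule balanced_nonzero[OF b]; simp add: finals_def)+
  ultimately show False by simp
qed

text \<open>Combining the three equations with the coefficients of a quadratic that vanishes at two
  of \<open>a\<close>, \<open>b\<close>, \<open>c\<close> isolates one summand. So each of the three
  coincides with another one, hence all do.\<close>

lemma vandermonde_3:
  fixes x y z a b c :: real
  assumes "x + y + z = 0" "a * x + b * y + c * z = 0" "a\<^sup>2 * x + b\<^sup>2 * y + c\<^sup>2 * z = 0"
    and "x \<noteq> 0" "y \<noteq> 0" "z \<noteq> 0"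
  shows "a = b" "a = c"
proof -
  have "(a - b) * (a - c) * x = a\<^sup>2 * x + b\<^sup>2 * y + c\<^sup>2 * z - (b + c) * (a * x + b * y + c * z)
      + b * c * (x + y + z)"
    "(b - a) * (b - c) * y = a\<^sup>2 * x + b\<^sup>2 * y + c\<^sup>2 * z - (a + c) * (a * x + b * y + c * z)
      + a * c * (x + y + z)"
    "(c - a) * (c - b) * z = a\<^sup>2 * x + b\<^sup>2 * y + c\<^sup>2 * z - (a + b) * (a * x + b * y + c * z)
      + a * b * (x + y + z)"
    by (simp_all add: algebra_simps power2_eq_square)
  then have "a = b \<or> a = c" "b = a \<or> b = c" "c = a \<or> c = b" using assms by simp_all
  then show "a = b" "a = c" by auto
qed

text \<open>
  Vertices 2, 3, 4 are joined to all of 0, 1, 5, 6. The vectors of weights at 0, 1 are orthogonal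
  to those at 5, 6, which by the triangles through the edges 01 and 56 amounts to three Vandermonde
  equations for the diagonal entries at 2, 3, 4. Hence these entries agree, and the weight vectors at 1
  and 6 are multiples of those at 0 and 5. Orthogonality of the rows 2, 3, 4 then says that
  \<open>W 0 i * W 0 j\<close> and \<open>W 5 i * W 5 j\<close> have opposite signs for all three pairs; multiply these.
\<close>

lemma not_balanced_18: "\<not> balanced (finals ! 18) W D"
proof
  assume b: "balanced (finals ! 18) W D"
  note s = balanced_sym[OF b]
  have nz: "W 0 1 \<noteq> 0" "W 5 6 \<noteq> 0" "W 0 2 \<noteq> 0" "W 0 3 \<noteq> 0" "W 0 4 \<noteq> 0"
      "W 5 2 \<noteq> 0" "W 5 3 \<noteq> 0" "W 5 4 \<noteq> 0"
    by (rule balanced_nonzero[OF b]; simp add: finals_def)+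
  have orth: "W 0 2 * W 5 2 + W 0 3 * W 5 3 + W 0 4 * W 5 4 = 0"
      "W 0 2 * W 6 2 + W 0 3 * W 6 3 + W 0 4 * W 6 4 = 0"
      "W 1 2 * W 5 2 + W 1 3 * W 5 3 + W 1 4 * W 5 4 = 0"
      "W 1 2 * W 6 2 + W 1 3 * W 6 3 + W 1 4 * W 6 4 = 0"
    using balanced_eq[OF b, of 0 5] balanced_eq[OF b, of 0 6]
      balanced_eq[OF b, of 1 5] balanced_eq[OF b, of 1 6] by (simp_all add: finals_def)
  have tri: "W 0 1 * W 1 2 = - (D 0 + D 2) * W 0 2" "W 0 1 * W 1 3 = - (D 0 + D 3) * W 0 3"
      "W 0 1 * W 1 4 = - (D 0 + D 4) * W 0 4" "W 5 6 * W 6 2 = - (D 5 + D 2) * W 5 2"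
      "W 5 6 * W 6 3 = - (D 5 + D 3) * W 5 3" "W 5 6 * W 6 4 = - (D 5 + D 4) * W 5 4"
    using balanced_eq[OF b, of 0 2] balanced_eq[OF b, of 0 3] balanced_eq[OF b, of 0 4]
      balanced_eq[OF b, of 5 2] balanced_eq[OF b, of 5 3] balanced_eq[OF b, of 5 4]
      s[of 2 1] s[of 3 1] s[of 4 1] s[of 2 6] s[of 3 6] s[of 4 6]
    by (simp_all add: finals_def algebra_simps)
  have row: "W 0 i * W 0 j + W 1 i * W 1 j + W 5 i * W 5 j + W 6 i * W 6 j = 0"
    if "(i, j) \<in> {(2, 3), (2, 4), (3, 4)}" for i j
    using that balanced_eq[OF b, of i j] s[of i 0] s[of j 0] s[of i 1] s[of j 1]
      s[of i 5] s[of j 5] s[of i 6] s[of j 6]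
    by (auto simp: finals_def)
  define x y z where "x = W 0 2 * W 5 2" and "y = W 0 3 * W 5 3" and "z = W 0 4 * W 5 4"
  have e0: "x + y + z = 0" using orth(1) by (simp add: x_def y_def z_def)
  have "W 0 1 * (W 1 2 * W 5 2 + W 1 3 * W 5 3 + W 1 4 * W 5 4) =
      (W 0 1 * W 1 2) * W 5 2 + (W 0 1 * W 1 3) * W 5 3 + (W 0 1 * W 1 4) * W 5 4"
    by (simp add: algebra_simps)
  also have "\<dots> = - (D 0 * (x + y + z) + (D 2 * x + D 3 * y + D 4 * z))"
    unfolding tri by (simp add: x_def y_def z_def algebra_simps)
  finally have e1: "D 2 * x + D 3 * y + D 4 * z = 0" using orth(3) e0 by simp
  \<comment> \<open>Expanding \<open>(D 0 + D i) * (D 5 + D i)\<close> brings in the square of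
    \<open>D i\<close>; the lower terms vanish by \<open>e0\<close> and \<open>e1\<close>.\<close>
  have "W 0 1 * W 5 6 * (W 1 2 * W 6 2 + W 1 3 * W 6 3 + W 1 4 * W 6 4) =
      (W 0 1 * W 1 2) * (W 5 6 * W 6 2) + (W 0 1 * W 1 3) * (W 5 6 * W 6 3) +
      (W 0 1 * W 1 4) * (W 5 6 * W 6 4)"
    by (simp add: algebra_simps)
  also have "\<dots> = D 0 * D 5 * (x + y + z) + (D 0 + D 5) * (D 2 * x + D 3 * y + D 4 * z) +
      ((D 2)\<^sup>2 * x + (D 3)\<^sup>2 * y + (D 4)\<^sup>2 * z)"
    unfolding tri by (simp add: x_def y_def z_def algebra_simps power2_eq_square)
  finally have e2: "(D 2)\<^sup>2 * x + (D 3)\<^sup>2 * y + (D 4)\<^sup>2 * z = 0"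
    using orth(4) e0 e1 by simp
  have D: "D 2 = D 3" "D 2 = D 4"
    using vandermonde_3[OF e0 e1 e2] nz by (simp_all add: x_def y_def z_def)
  define \<beta> \<gamma> where "\<beta> = - (D 0 + D 2) / W 0 1" and "\<gamma> = - (D 5 + D 2) / W 5 6"
  have \<beta>: "W 1 i = \<beta> * W 0 i" and \<gamma>: "W 6 i = \<gamma> * W 5 i" if "i \<in> {2, 3, 4}" for i
    using that tri nz D by (auto simp: \<beta>_def \<gamma>_def field_simps)
  have row': "(1 + \<beta>\<^sup>2) * (W 0 i * W 0 j) = - ((1 + \<gamma>\<^sup>2) * (W 5 i * W 5 j))"
    if "(i, j) \<in> {(2, 3), (2, 4), (3, 4)}" for i j
  proof -
    have ij: "i \<in> {2, 3, 4}" "j \<in> {2, 3, 4}" using that by auto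
    show ?thesis
      using row[OF that] unfolding \<beta>[OF ij(1)] \<beta>[OF ij(2)] \<gamma>[OF ij(1)] \<gamma>[OF ij(2)]
      by (simp add: algebra_simps power2_eq_square)
  qed
  have "0 < (1 + \<beta>\<^sup>2) ^ 3 * (W 0 2 * W 0 3 * W 0 4)\<^sup>2"
    using nz by (intro mult_pos_pos) (auto intro!: zero_less_power add_pos_nonneg)
  also have "\<dots> = ((1 + \<beta>\<^sup>2) * (W 0 2 * W 0 3)) * ((1 + \<beta>\<^sup>2) * (W 0 2 * W 0 4)) *
      ((1 + \<beta>\<^sup>2) * (W 0 3 * W 0 4))"
    by (simp add: power2_eq_square power3_eq_cube)
  also have "\<dots> = - ((1 + \<gamma>\<^sup>2) ^ 3 * (W 5 2 * W 5 3 * W 5 4)\<^sup>2)"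
    using row'[of 2 3] row'[of 2 4] row'[of 3 4] by (simp add: power2_eq_square power3_eq_cube)
  also have "\<dots> \<le> 0" by (auto intro!: mult_nonneg_nonneg zero_le_power add_nonneg_nonneg)
  finally show False by simp
qed

section \<open>Isomorphisms\<close>

lemma graph_isoI:
  assumes wf: "pair_wf_digraph G" and c: "bij_betw c I (pverts G)" and h: "bij_betw h I (pverts H)"
    and sub: "parcs H \<subseteq> pverts H \<times> pverts H"
    and adj: "\<And>i j. i \<in> I \<Longrightarrow> j \<in> I \<Longrightarrow> (c i, c j) \<in> parcs G \<longleftrightarrow> (h i, h j) \<in> parcs H"
  shows "graph_iso G H"
proof -
  define g where "g = h \<circ> the_inv_into I c"
  \<comment> \<open>An arc is the pair of its ends, so the vertex map \<open>g\<close> determines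
    the arc map.\<close>
  let ?hom = "\<lparr>iso_verts = g, iso_arcs = map_prod g g, iso_head = snd, iso_tail = fst\<rparr>"
  have gc: "g (c i) = h i" if "i \<in> I" for i
    using c that by (simp add: g_def bij_betw_def the_inv_into_f_f)
  have g: "bij_betw g (pverts G) (pverts H)"
    unfolding g_def using bij_betw_the_inv_into[OF c] h by (rule bij_betw_trans)
  have G_sub: "parcs G \<subseteq> pverts G \<times> pverts G"
    using pair_wf_digraph.in_arcsD1[OF wf] pair_wf_digraph.in_arcsD2[OF wf] by auto
  have inj: "inj_on (map_prod g g) (parcs G)"
    by (rule inj_on_subset[OF _ G_sub]) (use g in \<open>auto simp: bij_betw_def intro: map_prod_inj_on\<close>)
  have img: "map_prod g g ` parcs G = parcs H"
  proof (intro equalityI subsetI)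
    fix e assume "e \<in> map_prod g g ` parcs G"
    then obtain u v where uv: "(u, v) \<in> parcs G" "e = (g u, g v)" by auto
    then obtain i j where ij: "i \<in> I" "u = c i" "j \<in> I" "v = c j"
      using G_sub c unfolding bij_betw_def by blast
    then show "e \<in> parcs H" using adj[of i j] uv gc by simp
  next
    fix e assume e: "e \<in> parcs H"
    then have "fst e \<in> h ` I" "snd e \<in> h ` I" using sub h by (auto simp: bij_betw_def)
    then obtain i j where ij: "i \<in> I" "j \<in> I" "e = (h i, h j)" by (metis image_iff prod.collapse)
    then have "(c i, c j) \<in> parcs G" "e = map_prod g g (c i, c j)" using adj[of i j] e gc by simp_all
    then show "e \<in> map_prod g g ` parcs G" by blast
  qed
  have "pre_digraph.digraph_isomorphism (with_proj G) ?hom"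
    unfolding pre_digraph.digraph_isomorphism_def
    using wf g inj by (auto simp: wf_digraph_wp_iff bij_betw_def)
  moreover have "with_proj H = app_iso ?hom (with_proj G)"
    using g img by (simp add: app_iso_def with_proj_def bij_betw_def)
  ultimately show ?thesis unfolding digraph_iso_def by blast
qed

text \<open>\<open>hs ! i\<close> is the vertex of \<open>H\<close> in the role of index
  \<open>i\<close>; by cardinality \<open>hs\<close> exhausts the vertices. Stated with
  \<open>list_all2\<close>, the condition unfolds on concrete lists without index lookups.\<close>

definition adjacency_list_of :: "nat list list \<Rightarrow> 'b list \<Rightarrow> 'b pair_pre_digraph \<Rightarrow> bool" where
  "adjacency_list_of A hs H \<longleftrightarrow> length hs = length A \<and> distinct hs \<and>
     set hs \<subseteq> pverts H \<and> finite (pverts H) \<and> card (pverts H) = length A \<and>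
     list_all2 (\<lambda>h ns. list_all2 (\<lambda>h' j. (h, h') \<in> parcs H \<longleftrightarrow> j \<in> set ns) hs [0..<length A]) hs A"

lemma graph_iso_adjacency_list:
  assumes wf: "pair_wf_digraph G" and c: "bij_betw c {..<length A} (pverts G)"
    and adj: "\<forall>i < length A. \<forall>j < length A. (c i, c j) \<in> parcs G \<longleftrightarrow> j \<in> set (A ! i)"
    and sub: "parcs H \<subseteq> pverts H \<times> pverts H" and H: "adjacency_list_of A hs H"
  shows "graph_iso G H"
proof (rule graph_isoI[OF wf c, where h = "(!) hs"])
  have len: "length hs = length A" using H by (simp add: adjacency_list_of_def)
  have "set hs = pverts H"
    using H by (intro card_subset_eq) (auto simp: adjacency_list_of_def distinct_card)
  then show "bij_betw ((!) hs) {..<length A} (pverts H)"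
    using H bij_betw_nth[of hs "{..<length A}" "pverts H"] by (simp add: adjacency_list_of_def)
  show "parcs H \<subseteq> pverts H \<times> pverts H" by (rule sub)
  fix i j assume ij: "i \<in> {..<length A}" "j \<in> {..<length A}"
  have "list_all2 (\<lambda>h' j. (hs ! i, h') \<in> parcs H \<longleftrightarrow> j \<in> set (A ! i)) hs [0..<length A]"
    using H ij len unfolding adjacency_list_of_def by (auto dest: list_all2_nthD)
  then have "(hs ! i, hs ! j) \<in> parcs H \<longleftrightarrow> j \<in> set (A ! i)"
    using ij len list_all2_nthD[of _ hs "[0..<length A]" j] by fastforce
  then show "(c i, c j) \<in> parcs G \<longleftrightarrow> (hs ! i, hs ! j) \<in> parcs H"
    using adj ij by auto
qed

lemma verts_simps:
  "pverts (undirected V E) = V"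
  "pverts (complete_graph n) = {..<n}"
  "pverts (complete_bipartite_graph m n) = {..<m} <+> {..<n}"
  "pverts (circulant n D) = {..<n}"
  "pverts (cycle_graph n) = {..<n}"
  "pverts (G \<box> H) = pverts G \<times> pverts H"
  by (simp_all add: undirected_def complete_graph_def complete_bipartite_graph_def circulant_def
      cycle_graph_def cartesian_product_def)

lemma arcs_simps:
  "(a, b) \<in> parcs (undirected V E) \<longleftrightarrow> (a, b) \<in> E \<or> (b, a) \<in> E"
  "(s, t) \<in> parcs (complete_graph n) \<longleftrightarrow> s < n \<and> t < n \<and> s \<noteq> t"
  "(s, t) \<in> parcs (circulant n D) \<longleftrightarrow>
     (s < n \<and> (\<exists>d \<in> D. t = (s + d) mod n)) \<or> (t < n \<and> (\<exists>d \<in> D. s = (t + d) mod n))"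
  "(s, t) \<in> parcs (cycle_graph n) \<longleftrightarrow>
     (s < n \<and> t = (s + 1) mod n) \<or> (t < n \<and> s = (t + 1) mod n)"
  "(Inl s, Inr t) \<in> parcs (complete_bipartite_graph m n) \<longleftrightarrow> s < m \<and> t < n"
  "(Inr t, Inl s) \<in> parcs (complete_bipartite_graph m n) \<longleftrightarrow> s < m \<and> t < n"
  "(Inl s, Inl t) \<notin> parcs (complete_bipartite_graph m n)"
  "(Inr s, Inr t) \<notin> parcs (complete_bipartite_graph m n)"
  "((u, v), (u', v')) \<in> parcs (G \<box> H) \<longleftrightarrow>
     (u = u' \<and> u \<in> pverts G \<and> (v, v') \<in> parcs H) \<or> ((u, u') \<in> parcs G \<and> v = v' \<and> v \<in> pverts H)"
  by (auto simp: undirected_def complete_graph_def complete_bipartite_graph_def circulant_def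
      cycle_graph_def cartesian_product_def)

section \<open>Closed candles as cyclic sequences of twin pairs\<close>

definition candle_edge :: "nat \<Rightarrow> nat \<Rightarrow> nat \<Rightarrow> bool" where
  "candle_edge k a b \<longleftrightarrow>
     odd a \<and> a + 2 \<le> 2 * k - 1 \<and> b = a + 2 \<or> a = 2 * k - 1 \<and> b = 1 \<or>
     even a \<and> 2 \<le> a \<and> a + 2 \<le> 2 * k \<and> b = a + 2 \<or> a = 2 * k \<and> b = 2 \<or>
     1 \<le> a \<and> a \<le> 2 * k \<and> 1 \<le> b \<and> b \<le> 2 * k \<and> odd a \<and> even b \<and>
       (b = a + 3 \<or> b + 1 = a \<or> a = 2 * k - 1 \<and> b = 2 \<or> a = 1 \<and> b = 2 * k)"

lemma closed_candle_arcs_iff: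
  "(a, b) \<in> parcs (closed_candle k) \<longleftrightarrow> candle_edge k a b \<or> candle_edge k b a"
proof -
  have z: "int y - int x = 3 \<longleftrightarrow> y = x + 3" "int y - int x = - 1 \<longleftrightarrow> y + 1 = x" for x y :: nat
    by linarith+
  have l: "(\<exists>i. (a = i \<and> b = i + 2) \<and> P i) \<longleftrightarrow> P a \<and> b = a + 2" for a b :: nat and P
    by auto
  show ?thesis
    unfolding closed_candle_def arcs_simps candle_edge_def Un_iff mem_Collect_eq case_prod_conv
      atLeastAtMost_iff singleton_iff prod.inject z l
    by argo
qed

text \<open>The summands \<open>0\<close> and \<open>1\<close> before the final \<open>+ 1\<close>
  are the parity bits \<open>x\<close>, \<open>y\<close> of the labels; left unsimplified, the
  equations match the goals of \<open>closed_candle_arcs\<close> literally.\<close>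

lemma candle_edge_parity:
  assumes "p < k" "q < k" "3 \<le> k"
  shows "candle_edge k (2 * p + 0 + 1) (2 * q + 0 + 1) \<longleftrightarrow> q = p + 1 \<or> p + 1 = k \<and> q = 0"
    and "candle_edge k (2 * p + 1 + 1) (2 * q + 1 + 1) \<longleftrightarrow> q = p + 1 \<or> p + 1 = k \<and> q = 0"
    and "candle_edge k (2 * p + 0 + 1) (2 * q + 1 + 1) \<longleftrightarrow>
      q = p + 1 \<or> p = q + 1 \<or> p + 1 = k \<and> q = 0 \<or> p = 0 \<and> q + 1 = k"
    and "\<not> candle_edge k (2 * p + 1 + 1) (2 * q + 0 + 1)"
  using assms by (auto simp: candle_edge_def) presburger+

text \<open>Pair \<open>p\<close> of the candle is \<open>2 * p + 1\<close>,
  \<open>2 * p + 2\<close>. The differences 3 and -1 join an odd vertex to the even vertex of the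
  next and of the previous pair, the two cycles join equal parities, and the exceptional edges close
  up the sequence.\<close>

lemma closed_candle_arcs:
  assumes "3 \<le> k" "i < 2 * k" "j < 2 * k"
  shows "(i + 1, j + 1) \<in> parcs (closed_candle k) \<longleftrightarrow>
    j div 2 = (i div 2 + 1) mod k \<or> j div 2 = (i div 2 + (k - 1)) mod k"
proof -
  obtain p x where i: "i = 2 * p + x" "x < 2" by (metis mod_less_divisor mult_div_mod_eq pos2)
  obtain q y where j: "j = 2 * q + y" "y < 2" by (metis mod_less_divisor mult_div_mod_eq pos2)
  have d: "i div 2 = p" "j div 2 = q" using i j by auto
  have pq: "p < k" "q < k" using assms i j by auto
  have m1: "(p + 1) mod k = (if p + 1 = k then 0 else p + 1)"
    using pq by (auto simp: mod_if)
  have m2: "(p + (k - 1)) mod k = (if p = 0 then k - 1 else p - 1)"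
    using pq by (auto simp: mod_if)
  consider "x = 0" "y = 0" | "x = 0" "y = 1" | "x = 1" "y = 0" | "x = 1" "y = 1"
    using i j by linarith
  then have "candle_edge k (i + 1) (j + 1) \<or> candle_edge k (j + 1) (i + 1) \<longleftrightarrow>
    (q = p + 1 \<or> p + 1 = k \<and> q = 0) \<or> (p = q + 1 \<or> q + 1 = k \<and> p = 0)"
    unfolding i(1) j(1)
    using candle_edge_parity[OF pq assms(1)] candle_edge_parity[OF pq(2,1) assms(1)]
    by cases (simp_all only:, blast+)
  also have "\<dots> \<longleftrightarrow> q = (if p + 1 = k then 0 else p + 1) \<or> q = (if p = 0 then k - 1 else p - 1)"
    using pq assms(1) by (cases "p + 1 = k"; cases "p = 0"; auto)
  finally show ?thesis unfolding closed_candle_arcs_iff d m1 m2 .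
qed

lemma arcs_in_verts_undirected:
  "E \<subseteq> V \<times> V \<Longrightarrow> parcs (undirected V E) \<subseteq> pverts (undirected V E) \<times> pverts (undirected V E)"
  by (auto simp: undirected_def)

lemma arcs_in_verts_complete:
  "parcs (complete_graph n) \<subseteq> pverts (complete_graph n) \<times> pverts (complete_graph n)"
  by (auto simp: complete_graph_def undirected_def)

lemma arcs_in_verts_circulant:
  "parcs (circulant n D) \<subseteq> pverts (circulant n D) \<times> pverts (circulant n D)"
  by (auto simp: circulant_def undirected_def)

lemma arcs_in_verts_bipartite:
  "parcs (complete_bipartite_graph m n) \<subseteq>
     pverts (complete_bipartite_graph m n) \<times> pverts (complete_bipartite_graph m n)"
  by (auto simp: complete_bipartite_graph_def undirected_def)

lemma arcs_in_verts_product: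
  "parcs G \<subseteq> pverts G \<times> pverts G \<Longrightarrow> parcs H \<subseteq> pverts H \<times> pverts H \<Longrightarrow>
     parcs (G \<box> H) \<subseteq> pverts (G \<box> H) \<times> pverts (G \<box> H)"
  by (auto simp: cartesian_product_def)

lemmas arcs_in_verts = arcs_in_verts_complete arcs_in_verts_circulant arcs_in_verts_bipartite
  arcs_in_verts_product arcs_in_verts_undirected

lemma closed_candle_verts: "pverts (closed_candle k) = {1..2 * k}"
  by (simp add: closed_candle_def verts_simps)

lemma arcs_in_verts_closed_candle:
  assumes "3 \<le> k"
  shows "parcs (closed_candle k) \<subseteq> pverts (closed_candle k) \<times> pverts (closed_candle k)"
proof -
  have "a \<in> {1..2 * k} \<and> b \<in> {1..2 * k}" if "candle_edge k a b" for a b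
    using that assms unfolding candle_edge_def by (auto simp: Suc_le_eq odd_pos)
  then show ?thesis by (auto simp: closed_candle_arcs_iff closed_candle_verts)
qed

lemmas final_simps = finals_def adjacency_list_of_def verts_simps arcs_simps upt_rec card_Plus InlI InrI
  R_7_1_def R_8_2_def R_8_3_def R_8_4_def R_8_5_def R_8_6_def
  R_10_2_def R_10_3_def R_10_4_def R_12_3_def R_14_1_def hypercube4_def
  closed_candle_arcs_iff candle_edge_def closed_candle_verts

section \<open>Explicit isomorphisms for the 18 graphs that remain\<close>

lemma adjacency_complete_5:
  "adjacency_list_of (finals ! 0)
     [0, 1, 2, 3, 4]
     (complete_graph 5)"
  by (simp add: final_simps)

lemma adjacency_R_7_1:
  "adjacency_list_of (finals ! 1)
     [0, 1, 6, 2, 5, 3, 4]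
     R_7_1"
  by (simp add: final_simps)

lemma adjacency_R_8_2:
  "adjacency_list_of (finals ! 2)
     [1, 2, 3, 8, 6, 5, 4, 7]
     R_8_2"
  by (simp add: final_simps)

lemma adjacency_R_8_3:
  "adjacency_list_of (finals ! 3)
     [1, 5, 8, 2, 4, 7, 6, 3]
     R_8_3"
  by (simp add: final_simps)

lemma adjacency_R_8_4:
  "adjacency_list_of (finals ! 4)
     [7, 8, 1, 3, 6, 2, 5, 4]
     R_8_4"
  by (simp add: final_simps)

lemma adjacency_R_8_5:
  "adjacency_list_of (finals ! 5)
     [(0, 0), (1, 0), (2, 0), (3, 0), (0, 1), (1, 1), (2, 1), (3, 1)]
     R_8_5"
  by (simp add: final_simps)

lemma adjacency_R_8_6:
  "adjacency_list_of (finals ! 6)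
     [0, 1, 7, 2, 6, 3, 5, 4]
     R_8_6"
  by (simp add: final_simps)

lemma adjacency_complete_3_cycle_4:
  "adjacency_list_of (finals ! 7)
     [(0, 0), (2, 0), (1, 0), (0, 1), (0, 3), (2, 1), (2, 3), (1, 1), (1, 3), (0, 2), (2, 2), (1,
     2)]
     (complete_graph 3 \<box> cycle_graph 4)"
  by (simp add: final_simps)

lemma adjacency_complete_bipartite_3_3_complete_2:
  "adjacency_list_of (finals ! 8)
     [(Inl 0, 0), (Inr 1, 0), (Inr 2, 0), (Inr 0, 0), (Inl 0, 1), (Inl 1, 0), (Inl 2, 0), (Inr 1,
     1), (Inr 2, 1), (Inr 0, 1), (Inl 1, 1), (Inl 2, 1)]
     (complete_bipartite_graph 3 3 \<box> complete_graph 2)"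
  by (simp add: final_simps)

lemma adjacency_R_10_2:
  "adjacency_list_of (finals ! 9)
     [9, 2, 6, 4, 8, 3, 1, 5, 7, 10]
     R_10_2"
  by (simp add: final_simps)

lemma adjacency_R_10_3:
  "adjacency_list_of (finals ! 10)
     [1, 2, 3, 4, 5, 8, 10, 9, 6, 7]
     R_10_3"
  by (simp add: final_simps)

lemma adjacency_R_10_4:
  "adjacency_list_of (finals ! 11)
     [0, 1, 3, 9, 7, 2, 4, 8, 6, 5]
     R_10_4"
  by (simp add: final_simps)

lemma adjacency_R_12_3:
  "adjacency_list_of (finals ! 12)
     [0, 11, 1, 9, 3, 10, 2, 8, 4, 6, 7, 5]
     R_12_3"
  by (simp add: final_simps)

lemma adjacency_R_14_1:
  "adjacency_list_of (finals ! 13)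
     [1, 10, 13, 14, 8, 4, 5, 3, 7, 6, 2, 11, 9, 12]
     R_14_1"
  by (simp add: final_simps)

lemma adjacency_hypercube4:
  "adjacency_list_of (finals ! 14)
     [(((0, 0), 0), 0), (((1, 0), 0), 0), (((0, 0), 0), 1), (((0, 0), 1), 0), (((0, 1), 0), 0),
     (((1, 0), 0), 1), (((1, 0), 1), 0), (((1, 1), 0), 0), (((0, 0), 1), 1), (((0, 1), 0), 1),
     (((0, 1), 1), 0), (((1, 0), 1), 1), (((1, 1), 0), 1), (((1, 1), 1), 0), (((0, 1), 1), 1),
     (((1, 1), 1), 1)]
     hypercube4"
  by (simp add: final_simps)

lemma adjacency_closed_candle_3:
  "adjacency_list_of (finals ! 15)
     [1, 3, 5, 6, 4, 2]
     (closed_candle 3)"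
  by (simp add: final_simps)

lemma adjacency_closed_candle_4:
  "adjacency_list_of (finals ! 16)
     [1, 3, 4, 7, 8, 2, 5, 6]
     (closed_candle 4)"
  by (simp add: final_simps)

lemma adjacency_closed_candle_5:
  "adjacency_list_of (finals ! 17)
     [1, 9, 10, 3, 4, 2, 7, 8, 5, 6]
     (closed_candle 5)"
  by (simp add: final_simps)

section \<open>The theorem\<close>

lemma balanced_labelling:
  assumes "pair_graph G"
    and wsym: "\<And>u v. w u v = (w v u :: real)"
    and wnz: "\<And>u v. u \<in> pverts G \<Longrightarrow> v \<in> pverts G \<Longrightarrow> u \<noteq> v \<Longrightarrow> w u v \<noteq> 0 \<longleftrightarrow> (u, v) \<in> parcs G"
    and weq: "\<And>u v. u \<in> pverts G \<Longrightarrow> v \<in> pverts G \<Longrightarrow> u \<noteq> v \<Longrightarrow>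
      (d u + d v) * w u v + (\<Sum>x | (u, x) \<in> parcs G \<and> (v, x) \<in> parcs G. w u x * w v x) = 0"
    and c: "bij_betw c {..<length A} (pverts G)"
    and adj: "\<forall>i < length A. \<forall>j < length A. (c i, c j) \<in> parcs G \<longleftrightarrow> j \<in> set (A ! i)"
    and wf: "\<forall>ns \<in> set A. distinct ns \<and> (\<forall>j \<in> set ns. j < length A)"
  shows "balanced A (\<lambda>i j. w (c i) (c j)) (\<lambda>i. d (c i))"
proof -
  interpret pair_graph G by fact
  have cV: "c i \<in> pverts G" if "i < length A" for i using bij_betwE[OF c] that by auto
  have inj: "c i = c j \<longleftrightarrow> i = j" if "i < length A" "j < length A" for i j
    using c that by (auto simp: bij_betw_def inj_on_def)
  have lt: "j < length A" if "i < length A" "j \<in> set (A ! i)" for i j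
    using wf that nth_mem by blast
  have nz: "w (c i) (c j) \<noteq> 0 \<longleftrightarrow> j \<in> set (A ! i)" if "i < length A" "j < length A" "i \<noteq> j" for i j
    using wnz[OF cV cV] inj adj that by simp
  have loop: "i \<notin> set (A ! i)" if "i < length A" for i
    using adj that no_loops'[of "c i" "c i"] by blast
  have "(if j \<in> set (A ! i) then (d (c i) + d (c j)) * w (c i) (c j) else 0) +
      (\<Sum>k \<leftarrow> filter (\<lambda>k. k \<in> set (A ! j)) (A ! i). w (c i) (c k) * w (c j) (c k)) = 0"
    if ij: "i < length A" "j < length A" "i \<noteq> j" for i j
  proof -
    let ?K = "{k \<in> set (A ! i). k \<in> set (A ! j)}"
    have "{x. (c i, x) \<in> parcs G \<and> (c j, x) \<in> parcs G} = c ` ?K"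
    proof (intro equalityI subsetI)
      fix x assume "x \<in> {x. (c i, x) \<in> parcs G \<and> (c j, x) \<in> parcs G}"
      then have x: "(c i, x) \<in> parcs G" "(c j, x) \<in> parcs G" by auto
      then have "x \<in> c ` {..<length A}" using in_arcsD2 c by (auto simp: bij_betw_def)
      then obtain k where "k < length A" "x = c k" by auto
      then show "x \<in> c ` ?K" using x adj ij by auto
    next
      fix x assume "x \<in> c ` ?K"
      then show "x \<in> {x. (c i, x) \<in> parcs G \<and> (c j, x) \<in> parcs G}" using adj ij lt by auto
    qed
    moreover have "inj_on c ?K" using inj lt[OF ij(1)] by (auto simp: inj_on_def)
    \<comment> \<open>Distinctness of the adjacency lists turns the list sum into a sum over a set,
      which \<open>c\<close> carries to the common neighbours in \<open>G\<close>.\<close>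
    moreover have "(\<Sum>k \<leftarrow> filter (\<lambda>k. k \<in> set (A ! j)) (A ! i). w (c i) (c k) * w (c j) (c k)) =
        (\<Sum>k \<in> ?K. w (c i) (c k) * w (c j) (c k))"
      using wf ij by (subst sum_list_distinct_conv_sum_set) auto
    ultimately have "(d (c i) + d (c j)) * w (c i) (c j) +
        (\<Sum>k \<leftarrow> filter (\<lambda>k. k \<in> set (A ! j)) (A ! i). w (c i) (c k) * w (c j) (c k)) = 0"
      using weq[OF cV[OF ij(1)] cV[OF ij(2)]] inj ij by (simp add: sum.reindex)
    then show ?thesis using nz[OF ij] by auto
  qed
  then show ?thesis
    unfolding balanced_def using wsym nz lt loop by (intro conjI allI impI ballI) (blast | metis)+
qed

lemma connected_closed:
  assumes "pair_graph G" "Digraph_Component.connected (with_proj G)"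
    and S: "S \<subseteq> pverts G" "S \<noteq> {}" "\<And>u v. u \<in> S \<Longrightarrow> (u, v) \<in> parcs G \<Longrightarrow> v \<in> S"
  shows "S = pverts G"
proof -
  interpret pair_graph G by fact
  \<comment> \<open>Connectedness is defined through the symmetric closure, which leaves a symmetric
    digraph unchanged.\<close>
  have ends: "arcs_ends (mk_symmetric (with_proj G)) = parcs G"
    using arcs_symmetric by (auto simp: parcs_mk_symmetric)
  obtain u where u: "u \<in> S" using S by auto
  have "v \<in> S" if "v \<in> pverts G" for v
  proof -
    have "(u, v) \<in> rtrancl_on (pverts G) (parcs G)"
      using assms(2) u S(1) that ends
      unfolding Digraph_Component.connected_def strongly_connected_def reachable_def by auto
    then show ?thesis by (induction rule: rtrancl_on_induct) (use u S in auto)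
  qed
  then show ?thesis using S by auto
qed

lemma quadrangular_if_q_graph_2:
  assumes "pair_graph G" and conn: "Digraph_Component.connected (with_proj G)"
    and deg: "\<forall>v \<in> pverts G. out_degree (with_proj G) v = 4"
    and wnz: "\<And>u v. u \<in> pverts G \<Longrightarrow> v \<in> pverts G \<Longrightarrow> u \<noteq> v \<Longrightarrow> w u v \<noteq> (0 :: real) \<longleftrightarrow> (u, v) \<in> parcs G"
    and weq: "\<And>u v. u \<in> pverts G \<Longrightarrow> v \<in> pverts G \<Longrightarrow> u \<noteq> v \<Longrightarrow>
      (d u + d v) * w u v + (\<Sum>x | (u, x) \<in> parcs G \<and> (v, x) \<in> parcs G. w u x * w v x) = 0"
  shows "quadrangular (pverts G) (\<lambda>u v. (u, v) \<in> parcs G)"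
proof -
  interpret pair_graph G by fact
  show ?thesis
  proof
    show "finite (pverts G)" by (rule pair_finite_verts)
    show "pverts G \<noteq> {}"
      using conn unfolding Digraph_Component.connected_def strongly_connected_def by simp
    show "(u, v) \<in> parcs G \<Longrightarrow> v \<in> pverts G" for u v by (rule in_arcsD2)
    show "(u, u) \<notin> parcs G" for u using no_loops' by blast
    show "(u, v) \<in> parcs G \<Longrightarrow> (v, u) \<in> parcs G" for u v by (rule arcs_symmetric)
    show "card {v. (u, v) \<in> parcs G} = 4" if "u \<in> pverts G" for u
    proof -
      have "out_arcs (with_proj G) u = Pair u ` {v. (u, v) \<in> parcs G}" by (auto simp: out_arcs_def)
      then have "out_degree (with_proj G) u = card {v. (u, v) \<in> parcs G}"
        unfolding out_degree_def by (simp add: card_image inj_on_def)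
      then show ?thesis using deg that by simp
    qed
    show "S = pverts G" if "S \<subseteq> pverts G" "S \<noteq> {}" "\<And>u v. u \<in> S \<Longrightarrow> (u, v) \<in> parcs G \<Longrightarrow> v \<in> S" for S
      by (rule connected_closed[OF assms(1) conn that])
    show "\<exists>y. y \<noteq> x \<and> (u, y) \<in> parcs G \<and> (v, y) \<in> parcs G"
      if "u \<noteq> v" "(u, v) \<notin> parcs G" "(u, x) \<in> parcs G" "(v, x) \<in> parcs G" for u v x
    \<comment> \<open>For non-adjacent \<open>u\<close>, \<open>v\<close> the first term of
      \<open>weq\<close> vanishes; a sole common neighbour would leave a single non-zero product
      equal to zero.\<close>
    proof (rule ccontr)
      assume "\<not> ?thesis"
      then have "{y. (u, y) \<in> parcs G \<and> (v, y) \<in> parcs G} = {x}" using that by auto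
      moreover have V: "u \<in> pverts G" "v \<in> pverts G" "x \<in> pverts G" using that in_arcsD1 in_arcsD2 by auto
      moreover have "w u v = 0" using wnz[OF V(1,2)] that by auto
      ultimately have "w u x * w v x = 0" using weq[OF V(1,2)] that by simp
      moreover have "u \<noteq> x" "v \<noteq> x" using that no_loops' by blast+
      ultimately show False using wnz[OF V(1,3)] wnz[OF V(2,3)] that by auto
    qed
  qed
qed

lemma graph_iso_closed_candle:
  assumes "pair_graph G" "quadrangular (pverts G) (\<lambda>u v. (u, v) \<in> parcs G)" and N: "3 \<le> N"
    and cl: "quadrangular.closed_chain (pverts G) (\<lambda>u v. (u, v) \<in> parcs G) P N"
  shows "graph_iso G (closed_candle N)"
proof -
  interpret pair_graph G by fact
  interpret quadrangular "pverts G" "\<lambda>u v. (u, v) \<in> parcs G" by fact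
  obtain c where c: "bij_betw c {..<2 * N} (pverts G)" and adj: "\<And>i j. i < 2 * N \<Longrightarrow> j < 2 * N \<Longrightarrow>
      (c i, c j) \<in> parcs G \<longleftrightarrow> j div 2 = (i div 2 + 1) mod N \<or> j div 2 = (i div 2 + (N - 1)) mod N"
    using closed_chain_labelling[OF cl N] by blast
  show ?thesis
  proof (rule graph_isoI[OF _ c, where h = "\<lambda>i. i + 1"])
    show "pair_wf_digraph G" ..
    show "bij_betw (\<lambda>i. i + 1) {..<2 * N} (pverts (closed_candle N))"
      unfolding closed_candle_verts
      by (rule bij_betw_byWitness[where f' = "\<lambda>i. i - 1"]) auto
    show "parcs (closed_candle N) \<subseteq> pverts (closed_candle N) \<times> pverts (closed_candle N)"
      by (rule arcs_in_verts_closed_candle[OF N])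
    show "(c i, c j) \<in> parcs G \<longleftrightarrow> (i + 1, j + 1) \<in> parcs (closed_candle N)"
      if "i \<in> {..<2 * N}" "j \<in> {..<2 * N}" for i j
      using adj closed_candle_arcs[OF N] that by simp
  qed
qed

theorem theorem2p4:
  fixes G :: "'a pair_pre_digraph"
  assumes "pair_graph G"
    and "Digraph_Component.connected (with_proj G)"
    and "\<forall>v \<in> pverts G. out_degree (with_proj G) v = 4"
    and "q_graph G = 2"
  shows "graph_iso G (complete_graph 5)
    \<or> (graph_iso G R_7_1 \<or> graph_iso G R_8_2 \<or> graph_iso G R_8_3 \<or> graph_iso G R_8_4
        \<or> graph_iso G R_8_5 \<or> graph_iso G R_8_6)
    \<or> (graph_iso G (complete_graph 3 \<box> cycle_graph 4)
        \<or> graph_iso G (complete_bipartite_graph 3 3 \<box> complete_graph 2)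
        \<or> graph_iso G R_10_2 \<or> graph_iso G R_10_3 \<or> graph_iso G R_10_4
        \<or> graph_iso G R_12_3 \<or> graph_iso G R_14_1)
    \<or> graph_iso G hypercube4
    \<or> (\<exists>k\<ge>3. graph_iso G (closed_candle k))"
proof -
  interpret pair_graph G by fact
  from q_graph_2_weights[OF assms(1,4)] obtain w d
    where w0: "\<forall>u v. w u v = (w v u :: real)"
      "\<forall>u \<in> pverts G. \<forall>v \<in> pverts G. u \<noteq> v \<longrightarrow> (w u v \<noteq> 0 \<longleftrightarrow> (u, v) \<in> parcs G)"
      "\<forall>u \<in> pverts G. \<forall>v \<in> pverts G. u \<noteq> v \<longrightarrow>
        (d u + d v) * w u v + (\<Sum>x | (u, x) \<in> parcs G \<and> (v, x) \<in> parcs G. w u x * w v x) = 0"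
    by (elim exE conjE)
  have w: "\<And>u v. w u v = w v u"
    "\<And>u v. u \<in> pverts G \<Longrightarrow> v \<in> pverts G \<Longrightarrow> u \<noteq> v \<Longrightarrow> w u v \<noteq> 0 \<longleftrightarrow> (u, v) \<in> parcs G"
    "\<And>u v. u \<in> pverts G \<Longrightarrow> v \<in> pverts G \<Longrightarrow> u \<noteq> v \<Longrightarrow>
      (d u + d v) * w u v + (\<Sum>x | (u, x) \<in> parcs G \<and> (v, x) \<in> parcs G. w u x * w v x) = 0"
    using w0 by simp_all
  have quad: "quadrangular (pverts G) (\<lambda>u v. (u, v) \<in> parcs G)"
    by (rule quadrangular_if_q_graph_2[OF assms(1-3) w(2,3)])
  interpret quadrangular "pverts G" "\<lambda>u v. (u, v) \<in> parcs G" by (rule quad)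
  consider (ladder) "occurs (bare ladder)" | (final) k where "k < 23" "occurs (bare (finals ! k))"
    using occurs_final_or_ladder length_finals by (metis in_set_conv_nth)
  then show ?thesis
  proof cases
    case ladder
    then obtain f where "realizes f (bare ladder)" unfolding occurs_def by blast
    then have "chain (\<lambda>p. {f (2 * p), f (2 * p + 1)}) (0 + 5)" using chain_ladder by simp
    then obtain N P where N: "5 \<le> N" and P: "closed_chain P N" using chain_closes by blast
    have "3 \<le> N" using N by simp
    then show ?thesis using graph_iso_closed_candle[OF assms(1) quad _ P] by blast
  next
    case (final k)
    let ?A = "finals ! k"
    have A: "?A \<in> set finals" using final(1) length_finals by (metis nth_mem)
    have wf: "\<forall>ns \<in> set ?A. distinct ns \<and> (\<forall>j \<in> set ns. j < length ?A)"
      by (rule bspec[OF wf_lists]) (use A in simp)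
    have full: "?A \<noteq> []" "\<forall>i < length ?A. length (?A ! i) = 4"
      using bspec[OF finals_full A] by auto
    obtain c where c: "bij_betw c {..<length ?A} (pverts G)"
      and adj: "\<forall>i < length ?A. \<forall>j < length ?A. (c i, c j) \<in> parcs G \<longleftrightarrow> j \<in> set (?A ! i)"
      using occurs_full[OF final(2)[unfolded bare_def] wf_bare[OF wf, unfolded bare_def] full] by blast
    have "balanced ?A (\<lambda>i j. w (c i) (c j)) (\<lambda>i. d (c i))"
      by (rule balanced_labelling[OF assms(1) w c adj wf])
    then have "k \<noteq> 18" "k \<noteq> 19" "k \<noteq> 20" "k \<noteq> 21" "k \<noteq> 22"
      using not_balanced_18 not_balanced_19 not_balanced_20 not_balanced_21 not_balanced_22 by auto
    then have "k < 18" using final(1) by arith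
    \<comment> \<open>The vertex type of \<open>H\<close> is generalized here, as the listed graphs
      live on numbers, pairs and sums.\<close>
    have iso: "graph_iso G H"
      if "k = l" "parcs H \<subseteq> pverts H \<times> pverts H" "adjacency_list_of (finals ! l) hs H"
      for l hs and H :: "'b pair_pre_digraph"
      using graph_iso_adjacency_list[OF pair_wf_digraph c adj that(2)] that(1,3) by simp
    have g0: "k = 0 \<Longrightarrow> graph_iso G (complete_graph 5)"
      by (rule iso[OF _ _ adjacency_complete_5])
        (assumption, simp only: arcs_in_verts)
    have g1: "k = 1 \<Longrightarrow> graph_iso G R_7_1"
      by (rule iso[OF _ _ adjacency_R_7_1])
        (assumption, simp only: R_7_1_def arcs_in_verts)
    have g2: "k = 2 \<Longrightarrow> graph_iso G R_8_2"
      by (rule iso[OF _ _ adjacency_R_8_2])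
        (assumption, unfold R_8_2_def, rule arcs_in_verts_undirected, simp)
    have g3: "k = 3 \<Longrightarrow> graph_iso G R_8_3"
      by (rule iso[OF _ _ adjacency_R_8_3])
        (assumption, unfold R_8_3_def, rule arcs_in_verts_undirected, simp)
    have g4: "k = 4 \<Longrightarrow> graph_iso G R_8_4"
      by (rule iso[OF _ _ adjacency_R_8_4])
        (assumption, unfold R_8_4_def, rule arcs_in_verts_undirected, simp)
    have g5: "k = 5 \<Longrightarrow> graph_iso G R_8_5"
      by (rule iso[OF _ _ adjacency_R_8_5])
        (assumption, simp only: R_8_5_def arcs_in_verts)
    have g6: "k = 6 \<Longrightarrow> graph_iso G R_8_6"
      by (rule iso[OF _ _ adjacency_R_8_6])
        (assumption, simp only: R_8_6_def arcs_in_verts)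
    have g7: "k = 7 \<Longrightarrow> graph_iso G (complete_graph 3 \<box> cycle_graph 4)"
      by (rule iso[OF _ _ adjacency_complete_3_cycle_4])
        (assumption, simp only: cycle_graph_def arcs_in_verts)
    have g8: "k = 8 \<Longrightarrow> graph_iso G (complete_bipartite_graph 3 3 \<box> complete_graph 2)"
      by (rule iso[OF _ _ adjacency_complete_bipartite_3_3_complete_2])
        (assumption, simp only: arcs_in_verts)
    have g9: "k = 9 \<Longrightarrow> graph_iso G R_10_2"
      by (rule iso[OF _ _ adjacency_R_10_2])
        (assumption, unfold R_10_2_def, rule arcs_in_verts_undirected, simp)
    have g10: "k = 10 \<Longrightarrow> graph_iso G R_10_3"
      by (rule iso[OF _ _ adjacency_R_10_3])
        (assumption, unfold R_10_3_def, rule arcs_in_verts_undirected, simp)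
    have g11: "k = 11 \<Longrightarrow> graph_iso G R_10_4"
      by (rule iso[OF _ _ adjacency_R_10_4])
        (assumption, simp only: R_10_4_def arcs_in_verts)
    have g12: "k = 12 \<Longrightarrow> graph_iso G R_12_3"
      by (rule iso[OF _ _ adjacency_R_12_3])
        (assumption, simp only: R_12_3_def arcs_in_verts)
    have g13: "k = 13 \<Longrightarrow> graph_iso G R_14_1"
      by (rule iso[OF _ _ adjacency_R_14_1])
        (assumption, unfold R_14_1_def, rule arcs_in_verts_undirected, simp)
    have g14: "k = 14 \<Longrightarrow> graph_iso G hypercube4"
      by (rule iso[OF _ _ adjacency_hypercube4])
        (assumption, simp only: hypercube4_def arcs_in_verts)
    have g15: "k = 15 \<Longrightarrow> graph_iso G (closed_candle 3)"
      by (rule iso[OF _ _ adjacency_closed_candle_3])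
        (assumption, rule arcs_in_verts_closed_candle, simp)
    have g16: "k = 16 \<Longrightarrow> graph_iso G (closed_candle 4)"
      by (rule iso[OF _ _ adjacency_closed_candle_4])
        (assumption, rule arcs_in_verts_closed_candle, simp)
    have g17: "k = 17 \<Longrightarrow> graph_iso G (closed_candle 5)"
      by (rule iso[OF _ _ adjacency_closed_candle_5])
        (assumption, rule arcs_in_verts_closed_candle, simp)
    have le: "(3::nat) \<le> 3" "(3::nat) \<le> 4" "(3::nat) \<le> 5" by simp_all
    have "k = 0 \<or> k = 1 \<or> k = 2 \<or> k = 3 \<or> k = 4 \<or> k = 5 \<or> k = 6 \<or>
      k = 7 \<or> k = 8 \<or> k = 9 \<or> k = 10 \<or> k = 11 \<or> k = 12 \<or> k = 13 \<or> k = 14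
      \<or> k = 15 \<or> k = 16 \<or> k = 17"
      using \<open>k < 18\<close> by arith
    then show ?thesis
      using le g0 g1 g2 g3 g4 g5 g6 g7 g8 g9 g10 g11 g12 g13 g14 g15 g16 g17
      by (elim disjE) blast+
  qed
qed

end
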